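(* Let $n$ be a positive integer, and for a prime $p$ let $v_p(n)$ denote the exponent of the highest power of $p$ dividing $n$. (1) If $v_p(n)\ge 3$ for some odd prime $p$, or $v_2(n)\ge 4$, then there exist an abelian group $G$ of order $n$ and a non-abelian nilpotent group $G'$ of order $n$ such that $\zeta_G(s)=\zeta_{G'}(s)$. (2) If $v_p(n)\le 2$ for every odd prime $p$ and $v_2(n)\le 3$, then any nilpotent group $G$ of order $n$ is determined up to isomorphism by its zeta function $\zeta_G(s)$ (that is, if $G'$ is a finite group with $\zeta_{G'}(s)=\zeta_G(s)$, then $G'\cong G$), and $\zeta_G(s)$ satisfies the symmetry $$\zeta_G(s)=\frac{1}{|G|^{s}}\,\zeta_G(-s)$$ if and only if $G$ is abelian.
   Context: All groups are finite. For a finite group $G$ and $m\ge 1$, let $a_m(G)$ be the number of subgroups of $G$ of order $m$. The zeta function of $G$ is $\zeta_G(s)=\sum_{m\ge1} a_m(G)\,m^{-s}=\sum_{H\le G}|H|^{-s}$, $s\in\mathbb C$. Equality of zeta functions means equality as functions of $s$ (equivalently, $a_m(G)=a_m(G')$ for all $m$). *)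

theory Defs
  imports "HOL-Analysis.Complex_Transcendental" "HOL-Algebra.Algebra" "HOL-Computational_Algebra.Primes"
begin

text \<open>The lower central series, indexed from \<open>0\<close>:
  \<open>\<gamma>\<^sub>0 = G\<close> and \<open>\<gamma>\<^sub>i\<^sub>+\<^sub>1 = [\<gamma>\<^sub>i, G]\<close>, the subgroup generated by all commutators.\<close>

primrec lower_central :: "('a, 'b) monoid_scheme \<Rightarrow> nat \<Rightarrow> 'a set" where
  "lower_central G 0 = carrier G"
| "lower_central G (Suc i) = generate G
     {x \<otimes>\<^bsub>G\<^esub> y \<otimes>\<^bsub>G\<^esub> inv\<^bsub>G\<^esub> x \<otimes>\<^bsub>G\<^esub> inv\<^bsub>G\<^esub> y | x y. x \<in> lower_central G i \<and> y \<in> carrier G}"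

locale nilpotent_group = group +
  assumes lower_central_terminates: "\<exists>c. lower_central G c = {\<one>}"

definition num_subgroups :: "('a, 'b) monoid_scheme \<Rightarrow> nat \<Rightarrow> nat" where
  "num_subgroups G m = card {H. subgroup H G \<and> card H = m}"

text \<open>Only meant for finite groups; the sum is over a finite index set in that case.\<close>

definition group_zeta :: "('a, 'b) monoid_scheme \<Rightarrow> complex \<Rightarrow> complex" where
  "group_zeta G s = (\<Sum>H | subgroup H G. of_nat (card H) powr (-s))"

text \<open>The Dirichlet series form. All terms with \<open>m > order G\<close> vanish, so it is a finite sum.\<close>

lemma group_zeta_eq_sum_num_subgroups:
  assumes "group G" and "finite (carrier G)"
  shows "group_zeta G s = (\<Sum>m = 1..order G. of_nat (num_subgroups G m) * of_nat m powr (-s))"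
proof -
  let ?S = "{H. subgroup H G}"
  have sub: "?S \<subseteq> Pow (carrier G)"
    by (auto dest: subgroup.subset)
  have fin: "finite ?S"
    using finite_subset[OF sub] assms(2) by simp
  have img: "card ` ?S \<subseteq> {1..order G}"
  proof
    fix m assume "m \<in> card ` ?S"
    then obtain H where H: "subgroup H G" and m: "m = card H" by blast
    have "H \<subseteq> carrier G" "\<one>\<^bsub>G\<^esub> \<in> H"
      using H by (auto dest: subgroup.subset subgroup.one_closed)
    moreover from this have "finite H"
      using assms(2) finite_subset by blast
    ultimately have "card H \<le> order G" "card H > 0"
      using assms(2) by (auto simp: order_def card_mono card_gt_0_iff)
    then show "m \<in> {1..order G}" using m by simp
  qed
  have "group_zeta G s =
      (\<Sum>m = 1..order G. \<Sum>H | H \<in> ?S \<and> card H = m. of_nat (card H) powr (-s))"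
    unfolding group_zeta_def
    using sum.group[OF fin _ img, of "\<lambda>H. of_nat (card H) powr (-s)"] by simp
  also have "\<dots> = (\<Sum>m = 1..order G. of_nat (num_subgroups G m) * of_nat m powr (-s))"
    by (rule sum.cong) (simp_all add: num_subgroups_def)
  finally show ?thesis .
qed

end

(*
  Part (1). Write n = p * p * c and let C(n/p) x C(p) and its modular twist live on the same set, with
  products (a, b)(a', b') = (a + a' + c t b a', b + b') for t = 0 and t = 1. A subgroup that contains
  (a, b) with p not dividing a contains (a, b)^c = (c a, 0), hence the whole group of correction terms
  (k c, 0); on any other subgroup the corrections vanish. So the two groups have literally the same
  subgroups.

  Part (2). Equality of zeta functions is equality of all subgroup counts. Nilpotency means that for every
  p there is exactly one Sylow p-subgroup, which the counts detect, and all p-subgroups lie in it; so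
  everything reduces to the Sylow subgroups, of order p, p^2 or 8. There the counts separate the
  isomorphism types, and the symmetry of the zeta function (multiplicative over coprime direct products)
  can fail only at order 8, where it says that there are as many subgroups of order 2 as of order 4.
*)

theory Submission
  imports Defs "HOL-Number_Theory.Cong"
begin

section \<open>The modular groups\<close>

text \<open>The bounds 3 and 4 come from the power formula. In the twisted group the
  \<open>c\<close>-th power of \<open>(a, b)\<close> has first coordinate
  \<open>c * a + c * t * a * b * (c choose 2)\<close>, and the last term has to vanish modulo
  \<open>p * c\<close>. For odd \<open>p\<close> this is automatic once p divides c, that is p^3
  divides n; for p = 2, with c even, it forces 4 to divide c, that is 16 to divide n. With p = c = 2
  the twist is the dihedral group of order 8, which its five involutions give away. The part of n
  prime to p is absorbed into c, so one construction covers all n. In part (2) \<open>G'\<close> is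
  not given as nilpotent; that its Sylow subgroups are normal is read off the counts. At order 8 no
  single count suffices: cyclic and quaternion share a_2 = 1, and three types share a_4 = 3. The
  pairs (a_2, a_4) are (1,1), (7,7), (3,3), (5,3), (1,3), with equal entries exactly for the abelian
  types. For the symmetry the odd part of the zeta function is divided out. Zeta functions can have
  complex zeros but are positive on the real line, and the point s = 1 already forces a_2 =
  a_4.\<close>

lemma (in group) subgroup_if_finite_mult_closed:
  assumes fin: "finite (carrier G)" and sub: "H \<subseteq> carrier G" and ne: "H \<noteq> {}"
    and cl: "\<And>x y. x \<in> H \<Longrightarrow> y \<in> H \<Longrightarrow> x \<otimes> y \<in> H"
  shows "subgroup H G"
proof (rule subgroupI)
  have pow: "x [^] Suc k \<in> H" if "x \<in> H" for x and k :: nat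
    using that sub by (induction k) (auto intro: cl)
  fix x assume x: "x \<in> H"
  then have xG: "x \<in> carrier G" using sub by auto
  obtain k where k: "order G = Suc k"
    using fin order_gt_0_iff_finite gr0_implies_Suc by blast
  have "x [^] k \<otimes> x = \<one>" using pow_order_eq_1[OF xG] k by simp
  then have "inv x = x [^] k" using xG inv_equality by simp
  \<comment> \<open>The powers known to lie in \<open>H\<close> have positive exponents, so
    \<open>k = 0\<close>, the trivial group, is treated apart.\<close>
  moreover have "x [^] k \<in> H"
  proof (cases k)
    case 0
    then have "order G = 1" using k by simp
    then have "carrier G = {\<one>}" using order_one_triv_iff by blast
    then show ?thesis using x sub 0 by auto
  next
    case (Suc k')
    then show ?thesis using pow x by blast
  qed
  ultimately show "inv x \<in> H" by simp
qed (use sub ne cl in auto)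

text \<open>Commutators lie in the centre \<open>Z\<close>, so the first step of the lower central
  series does too and the second is trivial. The commutator \<open>z\<close> enters through
  \<open>x y = z y x\<close>, which in coordinates can be checked without computing
  inverses.\<close>

lemma (in group) nilpotent_if_commutators_central:
  assumes "\<And>x y. x \<in> carrier G \<Longrightarrow> y \<in> carrier G \<Longrightarrow>
    \<exists>z \<in> carrier G. x \<otimes> y = z \<otimes> (y \<otimes> x) \<and> (\<forall>g \<in> carrier G. z \<otimes> g = g \<otimes> z)"
  shows "nilpotent_group G"
proof -
  define Z where "Z = {z \<in> carrier G. \<forall>g \<in> carrier G. z \<otimes> g = g \<otimes> z}"
  have memZ: "z \<in> Z" if "\<And>g. g \<in> carrier G \<Longrightarrow> z \<otimes> g = g \<otimes> z" "z \<in> carrier G" for z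
    using that by (simp add: Z_def)
  have Z: "subgroup Z G"
  proof (rule subgroupI)
    fix a assume a: "a \<in> Z"
    then have aG: "a \<in> carrier G" by (simp add: Z_def)
    have "inv a \<otimes> g = g \<otimes> inv a" if g: "g \<in> carrier G" for g
    proof -
      have "a \<otimes> g = g \<otimes> a" using a g by (simp add: Z_def)
      then show ?thesis using aG g by (metis inv_closed inv_solve_left inv_solve_right m_assoc m_closed)
    qed
    moreover have "inv a \<in> carrier G" using aG by simp
    ultimately show "inv a \<in> Z" by (intro memZ)
  next
    fix a b assume ab: "a \<in> Z" "b \<in> Z"
    have "a \<otimes> b \<otimes> g = g \<otimes> (a \<otimes> b)" if g: "g \<in> carrier G" for g
    proof -
      have *: "a \<in> carrier G" "b \<in> carrier G" "a \<otimes> g = g \<otimes> a" "b \<otimes> g = g \<otimes> b"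
        using ab g unfolding Z_def by blast+
      have "a \<otimes> b \<otimes> g = a \<otimes> (b \<otimes> g)" using *(1,2) g by (simp only: m_assoc)
      also have "\<dots> = a \<otimes> (g \<otimes> b)" using *(4) by (simp only:)
      also have "\<dots> = a \<otimes> g \<otimes> b" using *(1,2) g by (simp only: m_assoc)
      also have "\<dots> = g \<otimes> a \<otimes> b" using *(3) by (simp only:)
      also have "\<dots> = g \<otimes> (a \<otimes> b)" using *(1,2) g by (simp only: m_assoc)
      finally show ?thesis .
    qed
    moreover have "a \<otimes> b \<in> carrier G" using ab unfolding Z_def by blast
    ultimately show "a \<otimes> b \<in> Z" by (intro memZ)
  next
    have "\<one> \<in> Z" by (simp add: Z_def)
    then show "Z \<noteq> {}" by blast
  qed (auto simp: Z_def)
  have comm: "x \<otimes> y \<otimes> inv x \<otimes> inv y \<in> Z" if "x \<in> carrier G" "y \<in> carrier G" for x y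
  proof -
    from assms[OF that] obtain z where z: "z \<in> Z" "x \<otimes> y = z \<otimes> (y \<otimes> x)"
      by (auto simp: Z_def)
    have "z \<in> carrier G" using z by (simp add: Z_def)
    then have "x \<otimes> y \<otimes> inv x \<otimes> inv y = z"
      using that z(2) by (simp add: m_assoc inv_solve_right r_inv flip: inv_mult_group)
    then show ?thesis using z by simp
  qed
  have 1: "lower_central G 1 \<subseteq> Z"
    using generate_subgroup_incl[OF _ Z] comm by (auto intro!: generate_subgroup_incl[OF _ Z])
  have one: "\<one> \<in> lower_central G 1" by (simp add: generate.one)
  have "{x \<otimes> y \<otimes> inv x \<otimes> inv y | x y. x \<in> lower_central G 1 \<and> y \<in> carrier G} = {\<one>}" (is "?C = _")
  proof
    show "?C \<subseteq> {\<one>}"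
    proof
      fix w assume "w \<in> ?C"
      then obtain x y where w: "w = x \<otimes> y \<otimes> inv x \<otimes> inv y" "x \<in> lower_central G 1" "y \<in> carrier G" by blast
      then have "x \<in> Z" using 1 by blast
      then have x: "x \<in> carrier G" "x \<otimes> y = y \<otimes> x" using w(3) unfolding Z_def by blast+
      have "w = y \<otimes> x \<otimes> inv x \<otimes> inv y" using w(1) x(2) by (simp only:)
      also have "\<dots> = \<one>" using w(3) x(1) by (simp add: m_assoc)
      finally show "w \<in> {\<one>}" by simp
    qed
    show "{\<one>} \<subseteq> ?C" using one by (auto intro!: exI[of _ \<one>])
  qed
  then have "lower_central G (Suc 1) = {\<one>}"
    using generate_one by (simp only: lower_central.simps(2))
  then have "\<exists>c. lower_central G c = {\<one>}" by (rule exI)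
  then show ?thesis
    by (intro nilpotent_group.intro nilpotent_group_axioms.intro group_axioms)
qed

text \<open>Here \<open>c\<close> is n / p^2. The condition \<open>p dvd c\<close> makes
  \<open>b\<close> acting as multiplication by \<open>1 + b * c\<close> modulo \<open>p * c\<close>
  a homomorphism, since the cross term \<open>b * b' * c * c\<close> vanishes;
  \<open>p dvd (c choose 2)\<close> removes the correction term from \<open>c\<close>-th
  powers.\<close>

locale modular_params =
  fixes p c :: nat
  assumes p: "Factorial_Ring.prime p" and c0: "c > 0" and pc: "p dvd c" and pc2: "p dvd (c choose 2)"
begin

text \<open>\<open>pr a b\<close> encodes the pair of \<open>a\<close> mod \<open>p * c\<close> and \<open>b\<close> mod \<open>p\<close>. In these coordinates \<open>M t\<close> is the
  extension \<open>(a, b) (a', b') = (a + a' + c t b a', b + b')\<close>: the direct product for \<open>t = 0\<close>, and for \<open>t = 1\<close>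
  the semidirect product in which \<open>b\<close> acts as multiplication by \<open>1 + b c\<close>.\<close>

definition pr :: "nat \<Rightarrow> nat \<Rightarrow> nat" where
  "pr a b = (a mod (p * c)) * p + b mod p"

definition M :: "nat \<Rightarrow> nat monoid" where
  "M t = \<lparr>carrier = {..<p * c * p},
     mult = (\<lambda>x y. pr (x div p + y div p + c * t * (x mod p) * (y div p)) (x mod p + y mod p)),
     one = 0\<rparr>"

lemma p1: "p > 1" using p prime_gt_1_nat by blast
lemma p0: "p > 0" using p1 by simp

lemma pr_div [simp]: "pr a b div p = a mod (p * c)" and pr_mod [simp]: "pr a b mod p = b mod p"
  using p0 by (simp_all add: pr_def)

lemma pr_eqI: "[a = a'] (mod (p * c)) \<Longrightarrow> [b = b'] (mod p) \<Longrightarrow> pr a b = pr a' b'"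
  by (simp add: pr_def cong_def)

lemma pr_eq_iff: "pr a b = pr a' b' \<longleftrightarrow> [a = a'] (mod (p * c)) \<and> [b = b'] (mod p)"
  using pr_eqI pr_div pr_mod unfolding cong_def by metis

lemma pr_carrier [simp]: "pr a b \<in> carrier (M t)"
proof -
  have "a mod (p * c) \<le> p * c - 1" using c0 p0 by (simp add: Suc_le_eq flip: less_Suc_eq_le)
  then have "(a mod (p * c)) * p \<le> (p * c - 1) * p" by simp
  moreover have "b mod p < p" using p0 by simp
  moreover have "p * c * p = (p * c - 1) * p + p" using c0 p0
    by (simp add: diff_mult_distrib)
  ultimately have "pr a b < p * c * p" unfolding pr_def using add_le_less_mono by metis
  then show ?thesis by (simp add: M_def)
qed

lemma pr_surj: "x \<in> carrier (M t) \<Longrightarrow> pr (x div p) (x mod p) = x"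
  by (simp add: pr_def M_def less_mult_imp_div_less)

lemma carrier_cases: assumes "x \<in> carrier (M t)" obtains a b where "x = pr a b"
  using pr_surj[OF assms] by metis

lemma one_M: "\<one>\<^bsub>M t\<^esub> = pr 0 0" by (simp add: M_def pr_def)

text \<open>Reducing \<open>b\<close> modulo \<open>p\<close> changes \<open>c * t * b * a'\<close>
  by a multiple of \<open>p * c\<close>. So arbitrary representatives may be used, and group
  identities become congruences between the arguments of \<open>pr\<close>.\<close>

lemma mult_M [simp]: "pr a b \<otimes>\<^bsub>M t\<^esub> pr a' b' = pr (a + a' + c * t * b * a') (b + b')"
proof -
  have 1: "[c * (b mod p) = c * b] (mod (p * c))"
    by (simp add: cong_def mult.commute[of p c])
  have 2: "[x mod (p * c) = x] (mod (p * c))" for x by (simp add: cong_def)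
  have "[c * (b mod p) * (t * (a' mod (p * c))) = c * b * (t * a')] (mod (p * c))"
    by (rule cong_mult[OF 1 cong_mult[OF cong_refl 2]])
  then have "[a mod (p * c) + a' mod (p * c) + c * (b mod p) * (t * (a' mod (p * c))) = a + a' + c * b * (t * a')] (mod (p * c))"
    by (rule cong_add[OF cong_add[OF 2 2]])
  moreover have "c * t * x * y = c * x * (t * y)" for x y by (simp only: mult_ac)
  ultimately have "[a mod (p * c) + a' mod (p * c) + c * t * (b mod p) * (a' mod (p * c)) = a + a' + c * t * b * a'] (mod (p * c))"
    by (simp only:)
  moreover have "[b mod p + b' mod p = b + b'] (mod p)" by (simp add: cong_def mod_add_eq)
  ultimately have "pr (a mod (p * c) + a' mod (p * c) + c * t * (b mod p) * (a' mod (p * c))) (b mod p + b' mod p)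
    = pr (a + a' + c * t * b * a') (b + b')" by (rule pr_eqI)
  then show ?thesis by (simp only: M_def monoid.simps pr_div pr_mod)
qed

lemma cong_multI: "x = y + p * c * k \<Longrightarrow> [x = y] (mod (p * c))"
  by (simp add: cong_def)

lemma cong_multI': "y = x + p * c * k \<Longrightarrow> [x = y] (mod (p * c))"
  by (simp add: cong_def)

lemma group_M: "group (M t)"
proof (rule groupI)
  fix x y assume "x \<in> carrier (M t)" "y \<in> carrier (M t)"
  then show "x \<otimes>\<^bsub>M t\<^esub> y \<in> carrier (M t)" by (elim carrier_cases) simp
next
  show "\<one>\<^bsub>M t\<^esub> \<in> carrier (M t)" by (simp add: one_M)
next
  fix x y z assume "x \<in> carrier (M t)" "y \<in> carrier (M t)" "z \<in> carrier (M t)"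
  then obtain a b a' b' a'' b'' where xyz: "x = pr a b" "y = pr a' b'" "z = pr a'' b''"
    by (elim carrier_cases) blast
  obtain k where k: "c = p * k" using pc by (auto simp: dvd_def)
  \<comment> \<open>The first coordinates differ by \<open>c * t * b * (c * t * b' * a'')\<close>;
    the factor \<open>p\<close> of one \<open>c\<close> makes this a multiple of
    \<open>p * c\<close>.\<close>
  show "x \<otimes>\<^bsub>M t\<^esub> y \<otimes>\<^bsub>M t\<^esub> z = x \<otimes>\<^bsub>M t\<^esub> (y \<otimes>\<^bsub>M t\<^esub> z)"
    unfolding xyz mult_M
    by (intro pr_eqI cong_multI'[where k = "k * t * t * b * b' * a''"])
       (simp_all add: algebra_simps k)
next
  fix x assume "x \<in> carrier (M t)"
  then obtain a b where x: "x = pr a b" by (elim carrier_cases)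
  show "\<one>\<^bsub>M t\<^esub> \<otimes>\<^bsub>M t\<^esub> x = x" by (simp add: one_M x)
  \<comment> \<open>The inverse has second coordinate \<open>-b\<close> and first coordinate
    \<open>-(a + c * t * b' * a)\<close>; in the naturals \<open>p - 1\<close> and
    \<open>p * c - 1\<close> serve as -1.\<close>
  define b' where "b' = (p - 1) * b"
  define a' where "a' = (p * c - 1) * (a + c * t * b' * a)"
  have "b' + b = p * b" using p0 by (cases p) (simp_all add: b'_def)
  moreover have "a' + a + c * t * b' * a = 0 + p * c * (a + c * t * b' * a)"
    using p0 c0 by (cases "p * c") (simp_all add: a'_def)
  ultimately have "pr a' b' \<otimes>\<^bsub>M t\<^esub> x = pr 0 0"
    unfolding x mult_M by (intro pr_eqI cong_multI) (auto simp: cong_def)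
  then show "\<exists>y\<in>carrier (M t). y \<otimes>\<^bsub>M t\<^esub> x = \<one>\<^bsub>M t\<^esub>" using one_M pr_carrier by metis
qed

text \<open>A new factor on the right meets the accumulated second coordinate \<open>k * b\<close>
  and contributes \<open>c * t * (k * b) * a\<close>; the sum of \<open>0, ..., k - 1\<close> is the
  binomial coefficient.\<close>

lemma pow_M: "pr a b [^]\<^bsub>M t\<^esub> k = pr (k * a + c * t * a * b * (k choose 2)) (k * b)" for k :: nat
proof (induction k)
  case 0
  then show ?case by (simp add: one_M numeral_2_eq_2)
next
  case (Suc k)
  then show ?case by (simp add: algebra_simps numeral_2_eq_2)
qed

lemma subgroup_pow_closed:
  assumes "subgroup H (M t)" "x \<in> H" shows "x [^]\<^bsub>M t\<^esub> (k::nat) \<in> H"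
  using assms by (induction k) (auto simp: subgroup.one_closed subgroup.m_closed)

lemma central_subset:
  assumes H: "subgroup H (M t)" and x: "pr a b \<in> H" and a: "\<not> p dvd a"
  shows "pr (k * c) 0 \<in> H"
proof -
  obtain m where m: "c choose 2 = p * m" using pc2 by (auto simp: dvd_def)
  \<comment> \<open>The second coordinate \<open>c * b\<close> vanishes by \<open>p dvd c\<close>,
    the correction by \<open>p dvd (c choose 2)\<close>.\<close>
  have "pr a b [^]\<^bsub>M t\<^esub> c = pr (c * a) 0"
    unfolding pow_M using pc
    by (intro pr_eqI cong_multI[where k = "t * a * b * m"]) (auto simp: m cong_def algebra_simps)
  then have 1: "pr (c * a) 0 \<in> H" using subgroup_pow_closed[OF H x, of c] by simp
  have "coprime a p" using prime_imp_coprime[OF p a] by (simp add: coprime_commute)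
  \<comment> \<open>An inverse of \<open>a\<close> modulo \<open>p\<close> is enough: multiplied by
    \<open>c\<close>, the congruence holds modulo \<open>p * c\<close>.\<close>
  then obtain u where "[a * u = 1] (mod p)" using cong_solve_coprime_nat by auto
  then have "[c * (a * u) = c * 1] (mod (p * c))"
    by (simp add: cong_def mod_mult_mult1 mult.commute[of p c])
  then have "[c * (a * u) * k = c * 1 * k] (mod (p * c))" by (rule cong_mult) simp
  then have "pr (c * a) 0 [^]\<^bsub>M t\<^esub> (u * k) = pr (k * c) 0"
    unfolding pow_M by (intro pr_eqI) (simp_all add: mult_ac)
  then show ?thesis using subgroup_pow_closed[OF H 1, of "u * k"] by simp
qed

text \<open>The correction depends on the first coordinate \<open>a'\<close> of the right factor
  only modulo \<open>p\<close>. If \<open>p\<close> divides \<open>a'\<close>, the two products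
  agree; otherwise the right factor itself puts all corrections into \<open>H\<close>, including the
  one by which the products differ.\<close>

lemma subgroup_M_imp:
  assumes H: "subgroup H (M t)"
  shows "subgroup H (M t')"
proof -
  interpret M': group "M t'" by (rule group_M)
  have car: "carrier (M t) = carrier (M t')" by (simp add: M_def)
  show ?thesis
  proof (rule M'.subgroup_if_finite_mult_closed)
    show "finite (carrier (M t'))" by (simp add: M_def)
    show "H \<subseteq> carrier (M t')" using H car subgroup.subset by metis
    show "H \<noteq> {}" using H subgroup.one_closed by blast
    fix x y assume xH: "x \<in> H" and yH: "y \<in> H"
    then obtain a b a' b' where xy: "x = pr a b" "y = pr a' b'"
      using H subgroup.mem_carrier carrier_cases by metis
    have xyH: "x \<otimes>\<^bsub>M t\<^esub> y \<in> H" using H xH yH subgroup.m_closed by metis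
    show "x \<otimes>\<^bsub>M t'\<^esub> y \<in> H"
    proof (cases "p dvd a'")
      case True
      then obtain d where d: "a' = p * d" by (auto simp: dvd_def)
      have "[a + a' + c * s * b * a' = a + a'] (mod (p * c))" for s
        by (rule cong_multI[where k = "s * b * d"]) (simp add: d)
      then have "x \<otimes>\<^bsub>M t'\<^esub> y = x \<otimes>\<^bsub>M t\<^esub> y"
        unfolding xy mult_M by (intro pr_eqI) (metis cong_sym cong_trans, simp)
      then show ?thesis using xyH by simp
    next
      case False
      obtain q where q: "p = Suc q" using p0 gr0_implies_Suc by blast
      \<comment> \<open>As \<open>q\<close> is -1 modulo \<open>p\<close>, \<open>k\<close> stands
        for \<open>(t' - t) * b * a'\<close>, and \<open>pr (k * c) 0\<close> carries the product
        for \<open>t\<close> to the product for \<open>t'\<close>.\<close>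
      define k where "k = (t' + q * t) * b * a'"
      obtain m where m: "c = p * m" using pc by (auto simp: dvd_def)
      have "pr (k * c) 0 \<in> H" using central_subset[OF H] yH False xy by blast
      then have "(x \<otimes>\<^bsub>M t\<^esub> y) \<otimes>\<^bsub>M t\<^esub> pr (k * c) 0 \<in> H" using H xyH subgroup.m_closed by metis
      moreover have "(x \<otimes>\<^bsub>M t\<^esub> y) \<otimes>\<^bsub>M t\<^esub> pr (k * c) 0 = x \<otimes>\<^bsub>M t'\<^esub> y"
      proof -
        have "a + a' + c * t * b * a' + k * c + c * t * (b + b') * (k * c)
            = (a + a' + c * t' * b * a') + p * c * (t * b * a' + m * t * (b + b') * k)"
        proof -
          have "c * t * b * a' + k * c = c * t' * b * a' + p * c * (t * b * a')"
            by (simp add: k_def q algebra_simps)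
          moreover have "c * t * (b + b') * (k * c) = p * c * (m * t * (b + b') * k)"
            by (subst (2) m) (simp only: mult_ac)
          ultimately show ?thesis unfolding distrib_left[of "p * c"] by linarith
        qed
        from cong_multI[OF this] show ?thesis unfolding xy mult_M by (intro pr_eqI) simp_all
      qed
      ultimately show ?thesis by simp
    qed
  qed
qed

lemma zeta_M: "group_zeta (M t) = group_zeta (M t')"
proof -
  have "{H. subgroup H (M t)} = {H. subgroup H (M t')}" using subgroup_M_imp by blast
  then show ?thesis unfolding group_zeta_def by simp
qed

lemma order_M: "order (M t) = p * c * p" by (simp add: order_def M_def)

lemma comm_M0: "comm_group (M 0)"
proof (rule group.group_comm_groupI[OF group_M])
  fix x y assume "x \<in> carrier (M 0)" "y \<in> carrier (M 0)"
  then show "x \<otimes>\<^bsub>M 0\<^esub> y = y \<otimes>\<^bsub>M 0\<^esub> x" by (elim carrier_cases) (simp add: add.commute)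
qed

lemma not_comm_M1: "\<not> comm_group (M 1)"
proof
  assume "comm_group (M 1)"
  then interpret M1: comm_group "M 1" .
  have "pr 1 0 \<otimes>\<^bsub>M 1\<^esub> pr 0 1 = pr 0 1 \<otimes>\<^bsub>M 1\<^esub> pr 1 0" by (rule M1.m_comm) simp_all
  then have "[1 + 0 = 1 + c] (mod (p * c))" by (simp add: pr_eq_iff)
  then have "[0 = c] (mod (p * c))" by (simp only: cong_add_lcancel_nat)
  then have "p * c dvd c" using cong_0_iff cong_sym by blast
  then show False using p1 c0 by (simp add: nat_dvd_not_less)
qed

lemma nilpotent_M: "nilpotent_group (M t)"
proof -
  interpret Mt: group "M t" by (rule group_M)
  show ?thesis
  proof (rule Mt.nilpotent_if_commutators_central)
    fix x y assume "x \<in> carrier (M t)" "y \<in> carrier (M t)"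
    then obtain a b a' b' where xy: "x = pr a b" "y = pr a' b'" by (elim carrier_cases) blast
    obtain q where q: "p = Suc q" using p0 gr0_implies_Suc by blast
    \<comment> \<open>Again \<open>q\<close> is -1 modulo \<open>p\<close>: \<open>k * c\<close> is
      the difference of the corrections in \<open>x y\<close> and \<open>y x\<close>, and
      \<open>pr (k * c) 0\<close> is the commutator.\<close>
    define k where "k = t * b * a' + q * t * b' * a"
    obtain m where m: "c = p * m" using pc by (auto simp: dvd_def)
    have "[a + a' + c * t * b * a' = k * c + (a' + a + c * t * b' * a)] (mod p * c)"
      by (rule cong_multI'[where k = "t * b' * a"]) (simp add: k_def q algebra_simps)
    then have 1: "x \<otimes>\<^bsub>M t\<^esub> y = pr (k * c) 0 \<otimes>\<^bsub>M t\<^esub> (y \<otimes>\<^bsub>M t\<^esub> x)"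
      unfolding xy mult_M by (intro pr_eqI) (simp_all add: add.commute)
    have 2: "pr (k * c) 0 \<otimes>\<^bsub>M t\<^esub> g = g \<otimes>\<^bsub>M t\<^esub> pr (k * c) 0" if g: "g \<in> carrier (M t)" for g
    proof -
      obtain d e where g: "g = pr d e" using g by (elim carrier_cases)
      have "c * t * e * (k * c) = p * c * (t * e * k * m)"
        by (subst (2) m) (simp only: mult_ac)
      then show ?thesis unfolding g mult_M
        by (intro pr_eqI cong_multI'[where k = "t * e * k * m"]) auto
    qed
    show "\<exists>z\<in>carrier (M t). x \<otimes>\<^bsub>M t\<^esub> y = z \<otimes>\<^bsub>M t\<^esub> (y \<otimes>\<^bsub>M t\<^esub> x) \<and> (\<forall>g\<in>carrier (M t). z \<otimes>\<^bsub>M t\<^esub> g = g \<otimes>\<^bsub>M t\<^esub> z)"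
      using 1 2 pr_carrier by blast
  qed
qed

end

lemma exists_nonabelian_same_zeta:
  fixes n :: nat
  assumes "n > 0" and "(\<exists>p. Factorial_Ring.prime p \<and> odd p \<and> multiplicity p n \<ge> 3) \<or> multiplicity 2 n \<ge> 4"
  shows "\<exists>(G :: nat monoid) (G' :: nat monoid). comm_group G \<and> order G = n \<and>
              nilpotent_group G' \<and> \<not> comm_group G' \<and> order G' = n \<and> group_zeta G = group_zeta G'"
proof -
  obtain p c where "modular_params p c" and n: "n = p * c * p"
  proof (cases "multiplicity 2 n \<ge> 4")
    case True
    then have "2 ^ 4 dvd n" by (rule multiplicity_dvd')
    then obtain d where d: "n = 2 ^ 4 * d" by (auto simp: dvd_def)
    \<comment> \<open>Here \<open>c = 4 * d\<close>, and half of \<open>c * (c - 1)\<close> is still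
      even; for \<open>c = 2 * d\<close> with \<open>d\<close> odd it would be odd.\<close>
    have "4 * d * (4 * d - 1) = 2 * (2 * (d * (4 * d - 1)))" by simp
    then have "4 * d * (4 * d - 1) div 2 = 2 * (d * (4 * d - 1))"
      by (metis nonzero_mult_div_cancel_left zero_neq_numeral)
    then have "2 dvd (4 * d choose 2)" by (simp add: choose_two)
    then have "modular_params 2 (4 * d)"
      using assms(1) d by unfold_locales (auto simp: two_is_prime_nat)
    then show ?thesis using that d by simp
  next
    case False
    then obtain p where p: "Factorial_Ring.prime p" "odd p" "multiplicity p n \<ge> 3" using assms by blast
    then have "p ^ 3 dvd n" using multiplicity_dvd'[of 3 p n] by simp
    then obtain d where d: "n = p ^ 3 * d" by (auto simp: dvd_def)
    have "even (p * d * (p * d - 1))" by (cases "p * d") auto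
    then have "2 * (p * d choose 2) = p * d * (p * d - 1)"
      unfolding choose_two by (rule dvd_mult_div_cancel)
    then have "p dvd 2 * (p * d choose 2)" by simp
    \<comment> \<open>Oddness of \<open>p\<close> cancels the 2, so the condition on
      \<open>c choose 2\<close> follows from \<open>p dvd c\<close>.\<close>
    moreover have "coprime p 2" using p(2) by simp
    ultimately have "p dvd (p * d choose 2)" using coprime_dvd_mult_right_iff by blast
    then have "modular_params p (p * d)"
      using assms(1) d p by unfold_locales (auto intro: Nat.gr0I)
    then show ?thesis using that d by (simp add: power3_eq_cube mult_ac)
  qed
  then interpret modular_params p c by simp
  show ?thesis
    using comm_M0 nilpotent_M[of 1] not_comm_M1 order_M zeta_M[of 0 1] unfolding n by metis
qed

section \<open>Subgroup counts and zeta functions\<close>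

lemma (in group) finite_subgroups: "finite (carrier G) \<Longrightarrow> finite {H. subgroup H G}"
  by (rule finite_subset[of _ "Pow (carrier G)"]) (auto dest: subgroup.subset)

lemma (in group) card_subgroup_dvd: "subgroup H G \<Longrightarrow> card H dvd order G"
  using lagrange by (metis dvd_triv_right)

lemma (in group) num_subgroups_eq_0:
  assumes "\<not> m dvd order G" shows "num_subgroups G m = 0"
proof -
  have "{H. subgroup H G \<and> card H = m} = {}" using assms card_subgroup_dvd by blast
  then show ?thesis by (simp only: num_subgroups_def card.empty)
qed

lemma (in group) num_subgroups_1: "num_subgroups G 1 = 1"
proof -
  have "subgroup H G \<and> card H = 1 \<longleftrightarrow> H = {\<one>}" for H
    by (metis card_1_singletonE is_singletonI is_singleton_altdef singletonD subgroup.one_closed triv_subgroup)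
  then show ?thesis by (simp add: num_subgroups_def)
qed

lemma (in group) num_subgroups_order: "finite (carrier G) \<Longrightarrow> num_subgroups G (order G) = 1"
proof -
  assume "finite (carrier G)"
  then have "subgroup H G \<and> card H = order G \<longleftrightarrow> H = carrier G" for H
    using subgroup_self card_subset_eq subgroup.subset unfolding order_def by metis
  then show ?thesis by (simp add: num_subgroups_def)
qed

text \<open>At \<open>s = -k\<close> the hypothesis says that all moments \<open>\<Sum>m. f m * m ^ k\<close> vanish; hence \<open>f\<close> is orthogonal to
  the polynomial that vanishes on \<open>A\<close> except at \<open>m\<close>.\<close>

lemma dirichlet_polynomial_unique:
  fixes f :: "nat \<Rightarrow> complex"
  assumes A: "finite A" "0 \<notin> A" and zero: "\<And>s. (\<Sum>m\<in>A. f m * of_nat m powr (-s)) = 0" and m: "m \<in> A"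
  shows "f m = 0"
proof -
  have pow: "(\<Sum>m\<in>A. f m * of_nat m ^ k) = 0" for k
  proof -
    have "of_nat m powr (- (- of_nat k)) = (of_nat m ^ k :: complex)" if "m \<in> A" for m
      using that A(2) by (metis minus_minus of_nat_eq_0_iff powr_nat)
    then show ?thesis using zero[of "- of_nat k"] by simp
  qed
  have "(\<Sum>m\<in>A. f m * (\<Prod>j\<in>B. of_nat m - of_nat j) * of_nat m ^ k) = 0" if "finite B" for B k
    using that
  proof (induction B arbitrary: k)
    case (insert j B)
    have "(\<Sum>m\<in>A. f m * (\<Prod>j\<in>insert j B. of_nat m - of_nat j) * of_nat m ^ k)
      = (\<Sum>m\<in>A. f m * (\<Prod>j\<in>B. of_nat m - of_nat j) * of_nat m ^ Suc k)
        - of_nat j * (\<Sum>m\<in>A. f m * (\<Prod>j\<in>B. of_nat m - of_nat j) * of_nat m ^ k)"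
      using insert.hyps by (simp add: sum_distrib_left algebra_simps flip: sum_subtractf)
    then show ?case by (simp only: insert.IH mult_zero_right diff_zero)
  qed (simp add: pow)
  from this[of "A - {m}" 0] have "(\<Sum>i\<in>A. f i * (\<Prod>j\<in>A - {m}. of_nat i - of_nat j)) = 0"
    using A(1) by simp
  moreover have "(\<Prod>j\<in>A - {m}. of_nat i - of_nat j :: complex) = 0" if "i \<in> A - {m}" for i
    using A(1) that by (intro prod_zero) auto
  then have "(\<Sum>i\<in>A. f i * (\<Prod>j\<in>A - {m}. of_nat i - of_nat j)) = f m * (\<Prod>j\<in>A - {m}. of_nat m - of_nat j)"
    using A(1) m by (subst sum.remove[of _ m]) (auto intro!: sum.neutral)
  ultimately show ?thesis using A(1) by simp
qed

lemma num_subgroups_eq_if_zeta_eq: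
  assumes G: "group G" "finite (carrier G)" and H: "group H" "finite (carrier H)"
    and eq: "group_zeta G = group_zeta H"
  shows "num_subgroups G m = num_subgroups H m"
proof -
  \<comment> \<open>The orders are not yet known to agree; \<open>N\<close> is a common summation
    bound that also covers \<open>m\<close>.\<close>
  define N where "N = m + order G + order H"
  have ext: "group_zeta K s = (\<Sum>m = 1..N. of_nat (num_subgroups K m) * of_nat m powr (-s))"
    if "group K" "finite (carrier K)" "order K \<le> N" for K :: "('x, 'y) monoid_scheme" and s
    unfolding group_zeta_eq_sum_num_subgroups[OF that(1,2)]
  proof (rule sum.mono_neutral_left)
    have "order K > 0" using that(1,2) by (simp add: monoid.order_gt_0_iff_finite group.is_monoid)
    then have "\<not> i dvd order K" if "i \<in> {1..N} - {1..order K}" for i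
      using that by (auto dest: dvd_imp_le)
    then have "num_subgroups K i = 0" if "i \<in> {1..N} - {1..order K}" for i
      using that group.num_subgroups_eq_0[OF \<open>group K\<close>] by blast
    then show "\<forall>i\<in>{1..N} - {1..order K}. of_nat (num_subgroups K i) * of_nat i powr (-s) = (0::complex)"
      by simp
  qed (use that in auto)
  show ?thesis
  proof (cases "m = 0")
    case True
    then show ?thesis using group.num_subgroups_eq_0[of G m] group.num_subgroups_eq_0[of H m] G H
      by (simp add: monoid.order_gt_0_iff_finite group.is_monoid)
  next
    case False
    have "of_nat (num_subgroups G m) - of_nat (num_subgroups H m) = (0::complex)"
    proof (rule dirichlet_polynomial_unique[of "{1..N}" "\<lambda>m. of_nat (num_subgroups G m) - of_nat (num_subgroups H m)"])
      show "(\<Sum>m = 1..N. (of_nat (num_subgroups G m) - of_nat (num_subgroups H m)) * of_nat m powr (-s)) = (0::complex)" for s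
        using ext[OF G, of s] ext[OF H, of s] eq by (simp add: N_def left_diff_distrib sum_subtractf)
    qed (use False in \<open>auto simp: N_def\<close>)
    then show ?thesis by simp
  qed
qed

text \<open>The count at the group's own order is 1, and a nonzero count at \<open>m\<close> forces
  \<open>m\<close> to divide the order; so each order divides the other.\<close>

lemma order_eq_if_zeta_eq:
  assumes G: "group G" "finite (carrier G)" and H: "group H" "finite (carrier H)"
    and eq: "group_zeta G = group_zeta H"
  shows "order G = order H"
proof -
  note n = num_subgroups_eq_if_zeta_eq[OF assms]
  have "order G dvd order H"
    using group.num_subgroups_order[OF G] n group.num_subgroups_eq_0[OF H(1)] by (metis zero_neq_one)
  moreover have "order H dvd order G"
    using group.num_subgroups_order[OF H] n group.num_subgroups_eq_0[OF G(1)] by (metis zero_neq_one)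
  ultimately show ?thesis by (rule dvd_antisym)
qed

section \<open>Isomorphism invariance and coprime direct products\<close>

lemma group_zeta_iso:
  assumes G: "group G" and H: "group H" and iso: "G \<cong> H"
  shows "group_zeta G = group_zeta H"
proof
  fix s
  obtain f where f: "f \<in> iso G H" using iso by (auto simp: is_iso_def)
  define g where "g = inv_into (carrier G) f"
  have g: "g \<in> iso H G" unfolding g_def using group.iso_set_sym[OF G f] .
  have bij: "bij_betw f (carrier G) (carrier H)" using f by (simp add: iso_def)
  have gf: "g ` f ` K = K" if "subgroup K G" for K
  proof -
    have "K \<subseteq> carrier G" using that by (rule subgroup.subset)
    then show ?thesis unfolding g_def using bij by (simp add: bij_betw_def inv_into_image_cancel)
  qed
  have fg: "f ` g ` K = K" if "subgroup K H" for K
  proof -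
    have "K \<subseteq> f ` carrier G" using that subgroup.subset bij by (metis bij_betw_imp_surj_on)
    then show ?thesis unfolding g_def by (rule image_inv_into_cancel[OF refl])
  qed
  show "group_zeta G s = group_zeta H s"
    unfolding group_zeta_def
  proof (rule sum.reindex_bij_witness[of _ "image g" "image f"])
    fix K assume "K \<in> {K. subgroup K G}"
    then have K: "subgroup K G" by simp
    show "f ` K \<in> {K. subgroup K H}" using subgroup.iso_subgroup[OF K G H f] by simp
    show "g ` f ` K = K" using gf[OF K] .
    have "inj_on f K" using bij subgroup.subset[OF K] by (meson bij_betw_def inj_on_subset)
    then show "of_nat (card (f ` K)) powr - s = (of_nat (card K) powr - s :: complex)" by (simp add: card_image)
  next
    fix K assume "K \<in> {K. subgroup K H}"
    then have K: "subgroup K H" by simp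
    show "g ` K \<in> {K. subgroup K G}" using subgroup.iso_subgroup[OF K H G g] by simp
    show "f ` g ` K = K" using fg[OF K] .
  qed
qed

lemma comm_group_iso:
  assumes "comm_group G" "group H" "G \<cong> H"
  shows "comm_group H"
  using assms comm_group.iso_imp_comm_group group.is_monoid by blast

lemma of_nat_mult_powr:
  "of_nat (a * b) powr s = of_nat a powr s * (of_nat b powr s :: complex)"
  by (simp add: powr_times_real)

lemma pow_DirProd:
  "group G \<Longrightarrow> group H \<Longrightarrow> (a, b) [^]\<^bsub>G \<times>\<times> H\<^esub> k = (a [^]\<^bsub>G\<^esub> k, b [^]\<^bsub>H\<^esub> (k::nat))"
  by (induction k) (auto simp: DirProd_def nat_pow_def)

lemma nat_pow_1_mod:
  assumes "group G" "x \<in> carrier G" "[e = f] (mod order G)"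
  shows "x [^]\<^bsub>G\<^esub> e = x [^]\<^bsub>G\<^esub> (f::nat)"
proof -
  interpret group G by fact
  have "int (ord x) dvd int f - int e"
    using assms(2,3) ord_dvd_group_order cong_dvd_modulus_nat
    by (metis cong_iff_dvd_diff cong_int_iff cong_sym)
  then show ?thesis using int_pow_eq[OF assms(2), of "int e" "int f"] by (simp add: int_pow_int)
qed

text \<open>For coprime orders the projections are power maps: the Chinese remainder theorem gives
  exponents \<open>e\<close> and \<open>f\<close> with \<open>(a, b)^e = (a, 1)\<close> and
  \<open>(a', b')^f = (1, b')\<close>. So \<open>S\<close> contains both components of its elements,
  and hence all products of them.\<close>

lemma subgroup_DirProd_coprime:
  assumes G: "group G" and H: "group H" and cop: "coprime (order G) (order H)"
    and S: "subgroup S (G \<times>\<times> H)"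
  shows "subgroup (fst ` S) G" "subgroup (snd ` S) H" "S = fst ` S \<times> snd ` S"
proof -
  interpret GH: group "G \<times>\<times> H" using G H by (rule DirProd_group)
  have "group_hom (G \<times>\<times> H) G fst" "group_hom (G \<times>\<times> H) H snd"
    using G H by (auto simp: group_hom_def group_hom_axioms_def hom_def GH.group_axioms)
  then show "subgroup (fst ` S) G" "subgroup (snd ` S) H"
    using S group_hom.subgroup_img_is_subgroup by blast+
  show "S = fst ` S \<times> snd ` S"
  proof
    show "fst ` S \<times> snd ` S \<subseteq> S"
    proof clarsimp
      fix a b' a' b assume 1: "(a, b) \<in> S" and 2: "(a', b') \<in> S"
      have car: "a \<in> carrier G" "a' \<in> carrier G" "b \<in> carrier H" "b' \<in> carrier H"
        using 1 2 subgroup.subset[OF S] by auto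
      obtain e where e: "[e = 1] (mod order G)" "[e = 0] (mod order H)"
        using binary_chinese_remainder_nat[OF cop] by blast
      obtain f where f: "[f = 0] (mod order G)" "[f = 1] (mod order H)"
        using binary_chinese_remainder_nat[OF cop] by blast
      have pow: "x [^]\<^bsub>G \<times>\<times> H\<^esub> k \<in> S" if "x \<in> S" for x and k :: nat
        using that S by (induction k) (auto simp: subgroup.m_closed subgroup.one_closed simp del: one_DirProd)
      have "(a, b) [^]\<^bsub>G \<times>\<times> H\<^esub> e = (a, \<one>\<^bsub>H\<^esub>)"
        using G H car nat_pow_1_mod[OF G car(1) e(1)] nat_pow_1_mod[OF H car(3) e(2)]
        by (simp add: pow_DirProd group.is_monoid)
      moreover have "(a', b') [^]\<^bsub>G \<times>\<times> H\<^esub> f = (\<one>\<^bsub>G\<^esub>, b')"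
        using G H car nat_pow_1_mod[OF G car(2) f(1)] nat_pow_1_mod[OF H car(4) f(2)]
        by (simp add: pow_DirProd group.is_monoid)
      ultimately have "(a, \<one>\<^bsub>H\<^esub>) \<in> S" "(\<one>\<^bsub>G\<^esub>, b') \<in> S" using pow 1 2 by metis+
      then have "(a, \<one>\<^bsub>H\<^esub>) \<otimes>\<^bsub>G \<times>\<times> H\<^esub> (\<one>\<^bsub>G\<^esub>, b') \<in> S" by (rule subgroup.m_closed[OF S])
      then show "(a, b') \<in> S" using G H car by (simp add: group.is_monoid)
    qed
  qed force
qed

lemma group_zeta_DirProd:
  assumes G: "group G" and H: "group H" and cop: "coprime (order G) (order H)"
  shows "group_zeta (G \<times>\<times> H) s = group_zeta G s * group_zeta H s"
proof -
  have "group_zeta G s * group_zeta H s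
    = (\<Sum>(A, B) \<in> {A. subgroup A G} \<times> {B. subgroup B H}. of_nat (card A) powr (-s) * of_nat (card B) powr (-s))"
    unfolding group_zeta_def by (simp add: sum_product sum.cartesian_product)
  also have "\<dots> = group_zeta (G \<times>\<times> H) s"
    unfolding group_zeta_def
  proof (rule sum.reindex_bij_witness[of _ "\<lambda>S. (fst ` S, snd ` S)" "\<lambda>(A, B). A \<times> B"], goal_cases)
    case (1 a)
    then obtain A B where a: "a = (A, B)" "subgroup A G" "subgroup B H" by auto
    then have "A \<noteq> {}" "B \<noteq> {}" using subgroup.one_closed by blast+
    then show ?case using a by (simp add: fst_image_times snd_image_times)
  next
    case (2 a)
    then show ?case using DirProd_subgroups[OF G _ H] by auto
  next
    case (3 S)
    then show ?case using subgroup_DirProd_coprime(3)[OF G H cop] by auto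
  next
    case (4 S)
    then show ?case using subgroup_DirProd_coprime(1,2)[OF G H cop] by auto
  next
    case (5 a)
    then show ?case by (auto simp: card_cartesian_product of_nat_mult_powr simp del: of_nat_mult)
  qed
  finally show ?thesis by simp
qed

lemma order_DirProd: "order (G \<times>\<times> H) = order G * order H"
  by (simp add: order_def card_cartesian_product)

section \<open>The functional equation\<close>

definition zeta_symmetric :: "('a, 'b) monoid_scheme \<Rightarrow> bool" where
  "zeta_symmetric G \<longleftrightarrow> (\<forall>s. group_zeta G s = 1 / of_nat (order G) powr s * group_zeta G (- s))"

lemma zeta_symmetric_iso:
  assumes "group G" "group H" "G \<cong> H"
  shows "zeta_symmetric G \<longleftrightarrow> zeta_symmetric H"
  using group_zeta_iso[OF assms] iso_same_card[OF assms(3)] by (simp add: zeta_symmetric_def order_def)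

text \<open>At a real argument every term is a positive real. This permits cancelling a factor in
  the functional equation of a direct product.\<close>

lemma group_zeta_of_real_nonzero:
  assumes "group G" "finite (carrier G)" shows "group_zeta G (of_real r) \<noteq> 0"
proof -
  have "group_zeta G (of_real r) = of_real (\<Sum>H | subgroup H G. real (card H) powr - r)"
    unfolding group_zeta_def by (simp flip: powr_of_real)
  moreover have "(\<Sum>H | subgroup H G. real (card H) powr - r) > 0"
  proof (rule sum_pos)
    show "{H. subgroup H G} \<noteq> {}" using group.subgroup_self[OF assms(1)] by blast
    fix H assume "H \<in> {H. subgroup H G}"
    then have "card H > 0" using assms subgroup.subset subgroup.one_closed
      by (metis card_gt_0_iff empty_iff finite_subset mem_Collect_eq)
    then show "real (card H) powr - r > 0" by simp
  qed (use group.finite_subgroups assms in blast)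
  ultimately show ?thesis by (metis less_irrefl of_real_eq_0_iff)
qed

lemma zeta_symmetric_DirProd:
  assumes G: "group G" and H: "group H" and cop: "coprime (order G) (order H)"
    and "zeta_symmetric G" "zeta_symmetric H"
  shows "zeta_symmetric (G \<times>\<times> H)"
  unfolding zeta_symmetric_def
proof
  fix s
  have "group_zeta G s = 1 / of_nat (order G) powr s * group_zeta G (- s)"
     "group_zeta H s = 1 / of_nat (order H) powr s * group_zeta H (- s)"
    using assms(4,5) unfolding zeta_symmetric_def by blast+
  from arg_cong2[OF this, of "(*)"] show "group_zeta (G \<times>\<times> H) s = 1 / of_nat (order (G \<times>\<times> H)) powr s * group_zeta (G \<times>\<times> H) (- s)"
    unfolding group_zeta_DirProd[OF G H cop] order_DirProd of_nat_mult_powr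
    by (simp only: mult_ac divide_divide_eq_left times_divide_eq_left mult_1_left)
qed

lemma group_zeta_sum_divisors:
  assumes "group G" "finite (carrier G)"
  shows "group_zeta G s = (\<Sum>d | d dvd order G. of_nat (num_subgroups G d) * of_nat d powr (-s))"
  unfolding group_zeta_eq_sum_num_subgroups[OF assms]
proof (rule sum.mono_neutral_right)
  have "order G > 0" using assms by (simp add: monoid.order_gt_0_iff_finite group.is_monoid)
  then show "{d. d dvd order G} \<subseteq> {1..order G}"
    using dvd_pos_nat by (fastforce dest: dvd_imp_le)
  show "\<forall>i\<in>{1..order G} - {d. d dvd order G}. of_nat (num_subgroups G i) * of_nat i powr (-s) = (0::complex)"
    using group.num_subgroups_eq_0[OF assms(1)] by auto
qed auto

text \<open>Reindex the divisor sum by \<open>d \<mapsto> order G div d\<close>: with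
  \<open>order G = d * e\<close> one has e^(-s) = |G|^(-s) d^s.\<close>

lemma zeta_symmetricI:
  assumes G: "group G" "finite (carrier G)"
    and sym: "\<And>d. d dvd order G \<Longrightarrow> num_subgroups G d = num_subgroups G (order G div d)"
  shows "zeta_symmetric G"
  unfolding zeta_symmetric_def
proof
  fix s
  have o: "order G > 0" using G by (simp add: monoid.order_gt_0_iff_finite group.is_monoid)
  have "group_zeta G s = (\<Sum>d | d dvd order G. of_nat (num_subgroups G (order G div d)) * of_nat (order G div d) powr (-s))"
    unfolding group_zeta_sum_divisors[OF G] using o
    by (intro sum.reindex_bij_witness[of _ "\<lambda>d. order G div d" "\<lambda>d. order G div d"]) (auto elim!: dvdE)
  also have "\<dots> = (\<Sum>d | d dvd order G. 1 / of_nat (order G) powr s * (of_nat (num_subgroups G d) * of_nat d powr s))"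
  proof (rule sum.cong[OF refl])
    fix d assume "d \<in> {d. d dvd order G}"
    then obtain e where e: "order G = d * e" and d: "d dvd order G" by auto
    have de: "d > 0" "e > 0" using o e by (auto intro: Nat.gr0I)
    have "order G div d = e" using e de by simp
    moreover have "of_nat e powr (-s) = 1 / of_nat (order G) powr s * (of_nat d powr s :: complex)"
      unfolding e of_nat_mult_powr using de by (simp add: powr_minus field_simps)
    ultimately show "of_nat (num_subgroups G (order G div d)) * of_nat (order G div d) powr (-s)
      = 1 / of_nat (order G) powr s * (of_nat (num_subgroups G d) * of_nat d powr s :: complex)"
      using sym[OF d] by (simp add: mult_ac)
  qed
  also have "\<dots> = 1 / of_nat (order G) powr s * group_zeta G (- s)"
    unfolding group_zeta_sum_divisors[OF G] sum_distrib_left by simp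
  finally show "group_zeta G s = 1 / of_nat (order G) powr s * group_zeta G (- s)" .
qed

section \<open>Normal Sylow subgroups and direct products\<close>

text \<open>If \<open>?m\<close> is the index, \<open>q^?m\<close> is trivial in the quotient and so
  lies in \<open>H\<close>. With \<open>?m * a\<close> congruent to 1 modulo \<open>k\<close>, the
  element \<open>q\<close> is the \<open>a\<close>-th power of \<open>q^?m\<close>.\<close>

lemma (in normal) mem_if_pow_coprime_index:
  assumes q: "q \<in> carrier G" "q [^] k = \<one>" and cop: "coprime k (card (rcosets H))"
  shows "q \<in> H"
proof -
  let ?m = "card (rcosets H)"
  interpret F: group "G Mod H" by (rule factorgroup_is_group)
  have "H #> q \<in> carrier (G Mod H)" using q by (simp add: carrier_FactGroup)
  then have "(H #> q) [^]\<^bsub>G Mod H\<^esub> order (G Mod H) = \<one>\<^bsub>G Mod H\<^esub>" by (rule F.pow_order_eq_1)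
  moreover have "order (G Mod H) = ?m" by (simp add: order_def FactGroup_def)
  ultimately have "H #> (q [^] ?m) = H" using FactGroup_pow[OF q(1), of ?m] by simp
  then have m: "q [^] ?m \<in> H" using q rcos_self[OF _ subgroup_axioms] nat_pow_closed by metis
  obtain a where a: "[?m * a = 1] (mod k)"
    using cop cong_solve_coprime_nat by (metis One_nat_def coprime_commute)
  have pow: "(q [^] ?m) [^] j \<in> H" for j :: nat using m by (induction j) auto
  have "ord q dvd k" using q pow_eq_id by blast
  then have "int (ord q) dvd int 1 - int (?m * a)"
    using a cong_dvd_modulus_nat by (metis cong_iff_dvd_diff cong_int_iff cong_sym)
  then have "q [^] int (?m * a) = q [^] int 1" using int_pow_eq[OF q(1)] by blast
  then have "q [^] (?m * a) = q" using q by (simp add: int_pow_int del: of_nat_mult)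
  then show ?thesis using pow[of a] q by (simp add: nat_pow_pow)
qed

lemma (in normal) coprime_subgroup_subset:
  assumes Q: "subgroup Q G" and cop: "coprime (card Q) (card (rcosets H))"
  shows "Q \<subseteq> H"
proof
  fix q assume q: "q \<in> Q"
  interpret Q: group "G\<lparr>carrier := Q\<rparr>" using Q by (rule subgroup_imp_group)
  have "q [^]\<^bsub>G\<lparr>carrier := Q\<rparr>\<^esub> card Q = \<one>" using Q.pow_order_eq_1[of q] q by (simp add: order_def)
  then have "q [^] card Q = \<one>" by (simp flip: nat_pow_consistent)
  then show "q \<in> H" using mem_if_pow_coprime_index[OF _ _ cop] q subgroup.subset[OF Q] by blast
qed

text \<open>Divisibility of \<open>n\<close> in place of equality lets this serve both for the index
  of a Sylow subgroup in the whole group and for its index in the normalizer.\<close>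

lemma coprime_sylow_index:
  assumes "Factorial_Ring.prime (p::nat)" "n > 0" "k * p ^ multiplicity p n dvd n"
  shows "coprime (p ^ j) k"
proof -
  have "\<not> p dvd k"
  proof
    assume "p dvd k"
    then have "p * p ^ multiplicity p n dvd k * p ^ multiplicity p n" by (rule mult_dvd_mono) simp
    then have "p ^ Suc (multiplicity p n) dvd n" using assms(3) by (metis dvd_trans power_Suc)
    then have "Suc (multiplicity p n) \<le> multiplicity p n"
      using assms prime_gt_1_nat by (intro multiplicity_geI) auto
    then show False by simp
  qed
  then show ?thesis using assms(1) by (simp add: prime_imp_coprime)
qed

lemma normal_sylow_contains:
  assumes P: "P \<lhd> G" and fin: "finite (carrier G)" and p: "Factorial_Ring.prime p"
    and cardP: "card P = p ^ multiplicity p (order G)"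
    and Q: "subgroup Q G" "card Q = p ^ j"
  shows "Q \<subseteq> P"
proof -
  interpret P: normal P G by fact
  have "card (rcosets\<^bsub>G\<^esub> P) * p ^ multiplicity p (order G) = order G"
    using P.lagrange[OF P.subgroup_axioms] cardP by simp
  then have "coprime (p ^ j) (card (rcosets\<^bsub>G\<^esub> P))"
    using fin P.order_gt_0_iff_finite by (intro coprime_sylow_index[OF p]) auto
  then show ?thesis using P.coprime_subgroup_subset[OF Q(1)] Q(2) by simp
qed

lemma num_subgroups_normal_sylow:
  assumes P: "P \<lhd> G" and fin: "finite (carrier G)" and p: "Factorial_Ring.prime p"
    and cardP: "card P = p ^ multiplicity p (order G)"
  shows "num_subgroups (G\<lparr>carrier := P\<rparr>) (p ^ j) = num_subgroups G (p ^ j)"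
proof -
  interpret P: normal P G by fact
  have "subgroup Q (G\<lparr>carrier := P\<rparr>) \<and> card Q = p ^ j \<longleftrightarrow> subgroup Q G \<and> card Q = p ^ j" for Q
    using normal_sylow_contains[OF assms, of Q j] P.incl_subgroup[OF P.subgroup_axioms, of Q]
      P.subgroup_incl[OF _ P.subgroup_axioms, of Q] by blast
  then show ?thesis by (simp add: num_subgroups_def)
qed

text \<open>The working form of nilpotency: for \<open>G\<close> it comes from the lower central
  series, for \<open>G'\<close> from the subgroup counts. Primes not dividing the order are
  included, with trivial \<open>P\<close>.\<close>

definition sylow_normal :: "('a, 'b) monoid_scheme \<Rightarrow> bool" where
  "sylow_normal G \<longleftrightarrow> (\<forall>p. Factorial_Ring.prime p \<longrightarrow> (\<exists>P. P \<lhd> G \<and> card P = p ^ multiplicity p (order G)))"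

text \<open>Take \<open>x\<close> outside \<open>H\<close> in the last term of the lower central
  series that is not contained in \<open>H\<close>. Commutators of \<open>x\<close> with
  \<open>h\<close> fall into the next term, hence into \<open>H\<close>, and the conjugate of
  \<open>h\<close> by \<open>x\<close> is such a commutator times \<open>h\<close>.\<close>

lemma (in nilpotent_group) exists_normalizing:
  assumes H: "subgroup H G" "H \<noteq> carrier G"
  shows "\<exists>x \<in> carrier G - H. \<forall>h \<in> H. x \<otimes> h \<otimes> inv x \<in> H"
proof -
  have car: "lower_central G i \<subseteq> carrier G" for i
  proof (induction i)
    case (Suc i)
    then show ?case by (auto intro!: generate_incl)
  qed simp
  obtain c where "lower_central G c = {\<one>}" using lower_central_terminates by blast
  then have ex: "\<exists>i. lower_central G i \<subseteq> H" using subgroup.one_closed[OF H(1)] by (intro exI[of _ c]) simp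
  define i where "i = (LEAST i. lower_central G i \<subseteq> H)"
  have i: "lower_central G i \<subseteq> H" unfolding i_def using ex by (rule LeastI_ex)
  have "i \<noteq> 0" using i H subgroup.subset by fastforce
  then obtain j where j: "i = Suc j" using not0_implies_Suc by blast
  then have "\<not> lower_central G j \<subseteq> H" using not_less_Least[of j] i_def by (metis lessI)
  then obtain x where x: "x \<in> lower_central G j" "x \<notin> H" by blast
  have xG: "x \<in> carrier G" using x car by blast
  have "x \<otimes> h \<otimes> inv x \<in> H" if h: "h \<in> H" for h
  proof -
    have hG: "h \<in> carrier G" using h H subgroup.subset by blast
    have "x \<otimes> h \<otimes> inv x \<otimes> inv h \<in> lower_central G (Suc j)"
      using x hG by (auto intro!: generate.incl)
    then have "x \<otimes> h \<otimes> inv x \<otimes> inv h \<in> H" using i j by blast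
    then have "x \<otimes> h \<otimes> inv x \<otimes> inv h \<otimes> h \<in> H" using h H(1) by (simp add: subgroup.m_closed)
    then show ?thesis using xG hG by (simp add: m_assoc)
  qed
  then show ?thesis using x xG by blast
qed

lemma (in group) nat_pow_conj:
  assumes "x \<in> carrier G" "h \<in> carrier G"
  shows "(x \<otimes> h \<otimes> inv x) [^] (k::nat) = x \<otimes> h [^] k \<otimes> inv x"
proof (induction k)
  case (Suc k)
  have "x \<otimes> h [^] k \<otimes> inv x \<otimes> (x \<otimes> h \<otimes> inv x) = x \<otimes> h [^] k \<otimes> (inv x \<otimes> x) \<otimes> h \<otimes> inv x"
    using assms by (simp only: m_assoc m_closed inv_closed nat_pow_closed)
  also have "\<dots> = x \<otimes> h [^] Suc k \<otimes> inv x" using assms by (simp add: m_assoc)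
  finally show ?case using Suc by simp
qed (use assms in simp)

text \<open>A Sylow subgroup \<open>P\<close> consists of all elements of its normalizer \<open>N\<close> of \<open>p\<close>-power order, so whatever
  normalizes \<open>N\<close> normalizes \<open>P\<close>; hence \<open>N\<close> is self-normalizing and must be all of \<open>G\<close>.\<close>

lemma (in nilpotent_group) sylow_normal:
  assumes fin: "finite (carrier G)"
  shows "sylow_normal G"
  unfolding sylow_normal_def
proof (intro allI impI)
  fix p :: nat assume p: "Factorial_Ring.prime p"
  let ?v = "multiplicity p (order G)"
  have o: "order G > 0" using fin order_gt_0_iff_finite by blast
  have "order G = p ^ ?v * (order G div p ^ ?v)" by (simp add: multiplicity_dvd)
  then obtain P where P: "subgroup P G" "card P = p ^ ?v"
    using sylow_thm[OF p group_axioms _ fin] by blast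
  have PG: "P \<subseteq> carrier G" using P(1) by (rule subgroup.subset)
  define N where "N = {g \<in> carrier G. \<forall>h \<in> P. g \<otimes> h \<otimes> inv g \<in> P}"
  have N: "subgroup N G"
  proof (rule subgroup_if_finite_mult_closed[OF fin])
    have "\<one> \<in> N" using PG by (auto simp: N_def)
    then show "N \<noteq> {}" by blast
    fix x y assume xy: "x \<in> N" "y \<in> N"
    have "x \<otimes> y \<otimes> h \<otimes> inv (x \<otimes> y) \<in> P" if h: "h \<in> P" for h
    proof -
      have "x \<otimes> (y \<otimes> h \<otimes> inv y) \<otimes> inv x \<in> P" using xy h by (simp add: N_def)
      moreover have "x \<otimes> y \<otimes> h \<otimes> inv (x \<otimes> y) = x \<otimes> (y \<otimes> h \<otimes> inv y) \<otimes> inv x"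
        using xy h PG by (auto simp: N_def inv_mult_group m_assoc)
      ultimately show ?thesis by simp
    qed
    then show "x \<otimes> y \<in> N" using xy by (simp add: N_def)
  qed (auto simp: N_def)
  have PN: "P \<subseteq> N"
    using PG P(1) by (auto simp: N_def intro!: subgroup.m_closed subgroup.m_inv_closed)
  let ?N = "G\<lparr>carrier := N\<rparr>"
  interpret N: group ?N using N by (rule subgroup_imp_group)
  have invN: "inv\<^bsub>?N\<^esub> x = inv x" if "x \<in> N" for x using m_inv_consistent[OF N that] .
  have "P \<lhd> ?N"
  proof (rule N.normal_invI)
    show "subgroup P ?N" using subgroup_incl[OF P(1) N PN] .
    fix x h assume "x \<in> carrier ?N" "h \<in> P"
    then show "x \<otimes>\<^bsub>?N\<^esub> h \<otimes>\<^bsub>?N\<^esub> inv\<^bsub>?N\<^esub> x \<in> P" using invN by (simp add: N_def)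
  qed
  then interpret PN: normal P ?N .
  have "card (rcosets\<^bsub>?N\<^esub> P) * p ^ ?v = card N"
    using N.lagrange[OF PN.subgroup_axioms] P(2) by (simp add: order_def)
  then have cop: "coprime (p ^ ?v) (card (rcosets\<^bsub>?N\<^esub> P))"
    using card_subgroup_dvd[OF N] by (intro coprime_sylow_index[OF p o]) simp
  have "N = carrier G"
  proof (rule ccontr)
    assume "N \<noteq> carrier G"
    then obtain x where x: "x \<in> carrier G" "x \<notin> N" "\<And>h. h \<in> N \<Longrightarrow> x \<otimes> h \<otimes> inv x \<in> N"
      using exists_normalizing[OF N] by blast
    have "x \<otimes> h \<otimes> inv x \<in> P" if h: "h \<in> P" for h
    proof (rule PN.mem_if_pow_coprime_index[OF _ _ cop])
      show "x \<otimes> h \<otimes> inv x \<in> carrier ?N" using x(3) PN h by auto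
      interpret PP: group "G\<lparr>carrier := P\<rparr>" using P(1) by (rule subgroup_imp_group)
      have "h [^]\<^bsub>G\<lparr>carrier := P\<rparr>\<^esub> card P = \<one>" using PP.pow_order_eq_1[of h] h by (simp add: order_def)
      then have "h [^] p ^ ?v = \<one>" using P(2) by (simp flip: nat_pow_consistent)
      then have "(x \<otimes> h \<otimes> inv x) [^] (p ^ ?v) = \<one>"
        using x(1) h PG nat_pow_conj by auto
      then show "(x \<otimes> h \<otimes> inv x) [^]\<^bsub>?N\<^esub> (p ^ ?v) = \<one>\<^bsub>?N\<^esub>" by (simp flip: nat_pow_consistent)
    qed
    then have "x \<in> N" using x(1) by (simp add: N_def)
    then show False using x(2) by simp
  qed
  then have "P \<lhd> G" using \<open>P \<lhd> ?N\<close> by simp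
  then show "\<exists>P. P \<lhd> G \<and> card P = p ^ ?v" using P(2) by blast
qed

lemma (in group) conjugate_subgroup:
  assumes x: "x \<in> carrier G" and P: "subgroup P G"
  shows "subgroup ((\<lambda>h. x \<otimes> h \<otimes> inv x) ` P) G" "card ((\<lambda>h. x \<otimes> h \<otimes> inv x) ` P) = card P"
proof -
  let ?c = "\<lambda>h. x \<otimes> h \<otimes> inv x"
  have c: "?c \<in> hom G G"
  proof (rule homI)
    fix a b assume ab: "a \<in> carrier G" "b \<in> carrier G"
    have "x \<otimes> a \<otimes> inv x \<otimes> (x \<otimes> b \<otimes> inv x) = x \<otimes> a \<otimes> (inv x \<otimes> x) \<otimes> b \<otimes> inv x"
      using x ab by (simp only: m_assoc m_closed inv_closed)
    then show "?c (a \<otimes> b) = ?c a \<otimes> ?c b" using x ab by (simp add: m_assoc)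
  qed (use x in simp)
  then show "subgroup (?c ` P) G"
    using P by (intro group_hom.subgroup_img_is_subgroup[of G G]) (auto simp: group_hom_def group_hom_axioms_def group_axioms)
  have "inj_on ?c P"
    using x subgroup.subset[OF P] by (intro inj_onI) (metis inv_closed l_cancel m_closed r_cancel subsetD)
  then show "card (?c ` P) = card P" by (rule card_image)
qed

text \<open>A conjugate of \<open>P\<close> is a subgroup of the same order, so uniqueness makes it
  equal to \<open>P\<close>.\<close>

lemma (in group) sylow_normal_if_num_subgroups:
  assumes one: "\<And>p. Factorial_Ring.prime p \<Longrightarrow> num_subgroups G (p ^ multiplicity p (order G)) = 1"
  shows "sylow_normal G"
  unfolding sylow_normal_def
proof (intro allI impI)
  fix p :: nat assume p: "Factorial_Ring.prime p"
  let ?q = "p ^ multiplicity p (order G)"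
  obtain P where P: "{H. subgroup H G \<and> card H = ?q} = {P}"
    using one[OF p] unfolding num_subgroups_def by (rule card_1_singletonE)
  then have sP: "subgroup P G" "card P = ?q" by blast+
  have "P \<lhd> G"
  proof (rule normal_invI[OF sP(1)])
    fix x h assume x: "x \<in> carrier G" and h: "h \<in> P"
    let ?c = "\<lambda>h. x \<otimes> h \<otimes> inv x"
    have "?c ` P \<in> {H. subgroup H G \<and> card H = ?q}"
      using conjugate_subgroup[OF x sP(1)] sP(2) by simp
    then have "?c ` P = P" unfolding P by (rule singletonD)
    then show "x \<otimes> h \<otimes> inv x \<in> P" using h by blast
  qed
  then show "\<exists>P. P \<lhd> G \<and> card P = ?q" using sP by blast
qed

section \<open>Recombining normal subgroups of coprime orders\<close>

lemma normal_inter_trivial: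
  assumes "A \<lhd> G" "B \<lhd> G" "coprime (card A) (card B)"
  shows "A \<inter> B = {\<one>\<^bsub>G\<^esub>}"
proof -
  interpret A: normal A G by fact
  interpret B: normal B G by fact
  have AB: "subgroup (A \<inter> B) G" using A.subgroups_Inter_pair A.subgroup_axioms B.subgroup_axioms by blast
  interpret GA: group "G\<lparr>carrier := A\<rparr>" using A.subgroup_axioms by (rule A.subgroup_imp_group)
  interpret GB: group "G\<lparr>carrier := B\<rparr>" using B.subgroup_axioms by (rule A.subgroup_imp_group)
  have "card (A \<inter> B) dvd card A"
    using GA.card_subgroup_dvd[OF A.subgroup_incl[OF AB A.subgroup_axioms]] by (simp add: order_def)
  moreover have "card (A \<inter> B) dvd card B"
    using GB.card_subgroup_dvd[OF A.subgroup_incl[OF AB B.subgroup_axioms]] by (simp add: order_def)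
  ultimately have "card (A \<inter> B) = 1" using assms(3) coprime_common_divisor_nat by blast
  then show ?thesis using subgroup.one_closed[OF AB] by (metis card_1_singletonE singletonD)
qed

lemma internal_direct_product_iso:
  assumes A: "A \<lhd> G" and B: "B \<lhd> G" and triv: "A \<inter> B = {\<one>\<^bsub>G\<^esub>}"
  shows "G\<lparr>carrier := A\<rparr> \<times>\<times> G\<lparr>carrier := B\<rparr> \<cong> G\<lparr>carrier := A <#>\<^bsub>G\<^esub> B\<rparr>"
proof -
  interpret A: normal A G by fact
  interpret B: normal B G by fact
  note comm = A.normal_imp_commuting[OF A B]
  let ?f = "\<lambda>(a, b). a \<otimes>\<^bsub>G\<^esub> b"
  have "?f \<in> hom (G\<lparr>carrier := A\<rparr> \<times>\<times> G\<lparr>carrier := B\<rparr>) (G\<lparr>carrier := A <#>\<^bsub>G\<^esub> B\<rparr>)"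
  proof (rule homI)
    fix x y assume "x \<in> carrier (G\<lparr>carrier := A\<rparr> \<times>\<times> G\<lparr>carrier := B\<rparr>)" "y \<in> carrier (G\<lparr>carrier := A\<rparr> \<times>\<times> G\<lparr>carrier := B\<rparr>)"
    then obtain a b c d where xy: "x = (a, b)" "y = (c, d)" "a \<in> A" "b \<in> B" "c \<in> A" "d \<in> B" by auto
    have 1: "b \<otimes>\<^bsub>G\<^esub> c = c \<otimes>\<^bsub>G\<^esub> b" using comm[of c b] triv xy by simp
    have car: "a \<in> carrier G" "b \<in> carrier G" "c \<in> carrier G" "d \<in> carrier G" using xy by auto
    have "a \<otimes>\<^bsub>G\<^esub> c \<otimes>\<^bsub>G\<^esub> (b \<otimes>\<^bsub>G\<^esub> d) = a \<otimes>\<^bsub>G\<^esub> (c \<otimes>\<^bsub>G\<^esub> b) \<otimes>\<^bsub>G\<^esub> d"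
      using car by (simp add: A.m_assoc)
    also have "\<dots> = a \<otimes>\<^bsub>G\<^esub> (b \<otimes>\<^bsub>G\<^esub> c) \<otimes>\<^bsub>G\<^esub> d" using 1 by simp
    also have "\<dots> = a \<otimes>\<^bsub>G\<^esub> b \<otimes>\<^bsub>G\<^esub> (c \<otimes>\<^bsub>G\<^esub> d)" using car by (simp add: A.m_assoc)
    finally show "?f (x \<otimes>\<^bsub>G\<lparr>carrier := A\<rparr> \<times>\<times> G\<lparr>carrier := B\<rparr>\<^esub> y) = ?f x \<otimes>\<^bsub>G\<lparr>carrier := A <#>\<^bsub>G\<^esub> B\<rparr>\<^esub> ?f y"
      using xy by simp
  qed (auto simp: set_mult_def)
  moreover have "bij_betw ?f (A \<times> B) (A <#>\<^bsub>G\<^esub> B)"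
  proof (rule bij_betw_imageI)
    have "a = c \<and> b = d" if "a \<in> A" "c \<in> A" "b \<in> B" "d \<in> B" "a \<otimes>\<^bsub>G\<^esub> b = c \<otimes>\<^bsub>G\<^esub> d" for a b c d
    proof -
      have "group_disjoint_sum G A B"
        by (simp add: group_disjoint_sum_def A.group_axioms A.subgroup_axioms B.subgroup_axioms)
      from group_disjoint_sum.cancel[OF this] show ?thesis using that triv by blast
    qed
    then show "inj_on ?f (A \<times> B)" by (auto simp: inj_on_def)
  qed (auto simp: set_mult_def)
  ultimately have "?f \<in> iso (G\<lparr>carrier := A\<rparr> \<times>\<times> G\<lparr>carrier := B\<rparr>) (G\<lparr>carrier := A <#>\<^bsub>G\<^esub> B\<rparr>)"
    by (simp add: iso_def)
  then show ?thesis by (rule is_isoI)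
qed

lemma normal_set_mult:
  assumes A: "A \<lhd> G" and B: "B \<lhd> G"
  shows "A <#>\<^bsub>G\<^esub> B \<lhd> G"
proof -
  interpret A: normal A G by fact
  interpret B: normal B G by fact
  have "subgroup (A <#>\<^bsub>G\<^esub> B) G"
    using second_isomorphism_grp.normal_set_mult_subgroup[of A G B]
    by (simp add: second_isomorphism_grp_def second_isomorphism_grp_axioms_def A B.subgroup_axioms)
  then show ?thesis
  proof (rule A.normal_invI)
    fix x h assume x: "x \<in> carrier G" and "h \<in> A <#>\<^bsub>G\<^esub> B"
    then obtain a b where h: "h = a \<otimes>\<^bsub>G\<^esub> b" "a \<in> A" "b \<in> B" by (auto simp: set_mult_def)
    then have car: "a \<in> carrier G" "b \<in> carrier G" by auto
    have "x \<otimes>\<^bsub>G\<^esub> a \<otimes>\<^bsub>G\<^esub> inv\<^bsub>G\<^esub> x \<in> A" "x \<otimes>\<^bsub>G\<^esub> b \<otimes>\<^bsub>G\<^esub> inv\<^bsub>G\<^esub> x \<in> B"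
      using x h A.inv_op_closed2 B.inv_op_closed2 by auto
    moreover have "x \<otimes>\<^bsub>G\<^esub> h \<otimes>\<^bsub>G\<^esub> inv\<^bsub>G\<^esub> x = x \<otimes>\<^bsub>G\<^esub> a \<otimes>\<^bsub>G\<^esub> inv\<^bsub>G\<^esub> x \<otimes>\<^bsub>G\<^esub> (x \<otimes>\<^bsub>G\<^esub> b \<otimes>\<^bsub>G\<^esub> inv\<^bsub>G\<^esub> x)"
    proof -
      have "x \<otimes>\<^bsub>G\<^esub> a \<otimes>\<^bsub>G\<^esub> inv\<^bsub>G\<^esub> x \<otimes>\<^bsub>G\<^esub> (x \<otimes>\<^bsub>G\<^esub> b \<otimes>\<^bsub>G\<^esub> inv\<^bsub>G\<^esub> x)
        = x \<otimes>\<^bsub>G\<^esub> a \<otimes>\<^bsub>G\<^esub> (inv\<^bsub>G\<^esub> x \<otimes>\<^bsub>G\<^esub> x) \<otimes>\<^bsub>G\<^esub> b \<otimes>\<^bsub>G\<^esub> inv\<^bsub>G\<^esub> x"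
        using x car by (simp only: A.m_assoc A.m_closed A.inv_closed)
      then show ?thesis using x car h(1) by (simp add: A.m_assoc)
    qed
    ultimately show "x \<otimes>\<^bsub>G\<^esub> h \<otimes>\<^bsub>G\<^esub> inv\<^bsub>G\<^esub> x \<in> A <#>\<^bsub>G\<^esub> B" unfolding set_mult_def by blast
  qed
qed

lemma coprime_prod_prime_powers:
  fixes e :: "nat \<Rightarrow> nat"
  assumes "\<And>q. q \<in> S \<Longrightarrow> Factorial_Ring.prime q" "Factorial_Ring.prime p" "p \<notin> S"
  shows "coprime (\<Prod>q\<in>S. q ^ e q) (p ^ k)"
  using assms by (intro prod_coprime_left coprime_power_left_iff[THEN iffD2] coprime_power_right_iff[THEN iffD2])
    (metis coprime_power_left_iff coprime_power_right_iff primes_coprime)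

lemma coprime_normal_set_mult:
  assumes A: "A \<lhd> G" and B: "B \<lhd> G" and cop: "coprime (card A) (card B)"
  shows "A <#>\<^bsub>G\<^esub> B \<lhd> G" "card (A <#>\<^bsub>G\<^esub> B) = card A * card B"
    "G\<lparr>carrier := A\<rparr> \<times>\<times> G\<lparr>carrier := B\<rparr> \<cong> G\<lparr>carrier := A <#>\<^bsub>G\<^esub> B\<rparr>"
proof -
  show iso: "G\<lparr>carrier := A\<rparr> \<times>\<times> G\<lparr>carrier := B\<rparr> \<cong> G\<lparr>carrier := A <#>\<^bsub>G\<^esub> B\<rparr>"
    using internal_direct_product_iso[OF A B normal_inter_trivial[OF A B cop]] .
  show "card (A <#>\<^bsub>G\<^esub> B) = card A * card B"
    using iso_same_card[OF iso] by (simp add: card_cartesian_product)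
  show "A <#>\<^bsub>G\<^esub> B \<lhd> G" using normal_set_mult[OF A B] .
qed

lemma normal_imp_group: "A \<lhd> G \<Longrightarrow> group (G\<lparr>carrier := A\<rparr>)"
  by (simp add: group.subgroup_imp_group normal_def)

text \<open>The induction multiplies in one Sylow subgroup at a time and stays with normal subgroups
  of the two fixed groups, in place of abstract products. When \<open>S\<close> consists of all
  prime factors, \<open>K\<close> and \<open>K'\<close> have full order and are the groups
  themselves.\<close>

lemma iso_normal_hall:
  fixes G :: "('a, 'c) monoid_scheme" and G' :: "('b, 'd) monoid_scheme"
  assumes G: "group G" and G': "group G'"
    and S: "finite S" "\<And>p. p \<in> S \<Longrightarrow> Factorial_Ring.prime p"
    and syl: "\<And>p. p \<in> S \<Longrightarrow> \<exists>P P'. P \<lhd> G \<and> P' \<lhd> G' \<and> card P = p ^ e p \<and> card P' = p ^ e p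
                 \<and> G'\<lparr>carrier := P'\<rparr> \<cong> G\<lparr>carrier := P\<rparr>"
  shows "\<exists>K K'. K \<lhd> G \<and> K' \<lhd> G' \<and> card K = (\<Prod>p\<in>S. p ^ e p) \<and> card K' = (\<Prod>p\<in>S. p ^ e p)
           \<and> G'\<lparr>carrier := K'\<rparr> \<cong> G\<lparr>carrier := K\<rparr>"
  using S syl
proof (induction S rule: finite_induct)
  case empty
  have "{\<one>\<^bsub>G\<^esub>} \<lhd> G" "{\<one>\<^bsub>G'\<^esub>} \<lhd> G'" using G G' group.one_is_normal by blast+
  moreover have "(\<lambda>_. \<one>\<^bsub>G\<^esub>) \<in> iso (G'\<lparr>carrier := {\<one>\<^bsub>G'\<^esub>}\<rparr>) (G\<lparr>carrier := {\<one>\<^bsub>G\<^esub>}\<rparr>)"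
    using G by (auto simp: iso_def hom_def bij_betw_def group.is_monoid)
  ultimately show ?case by (intro exI[of _ "{\<one>\<^bsub>G\<^esub>}"] exI[of _ "{\<one>\<^bsub>G'\<^esub>}"]) (auto intro: is_isoI)
next
  case (insert p S)
  obtain K K' where K: "K \<lhd> G" "K' \<lhd> G'" "card K = (\<Prod>p\<in>S. p ^ e p)" "card K' = (\<Prod>p\<in>S. p ^ e p)"
      and isoK: "G'\<lparr>carrier := K'\<rparr> \<cong> G\<lparr>carrier := K\<rparr>"
    using insert.IH insert.prems by blast
  obtain P P' where P: "P \<lhd> G" "P' \<lhd> G'" "card P = p ^ e p" "card P' = p ^ e p"
      and isoP: "G'\<lparr>carrier := P'\<rparr> \<cong> G\<lparr>carrier := P\<rparr>"
    using insert.prems by blast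
  have "coprime (\<Prod>p\<in>S. p ^ e p) (p ^ e p)"
    by (rule coprime_prod_prime_powers) (use insert.hyps insert.prems(1) in auto)
  then have cop: "coprime (card K) (card P)" "coprime (card K') (card P')"
    unfolding K P by simp_all
  note 1 = coprime_normal_set_mult[OF K(1) P(1) cop(1)]
  note 2 = coprime_normal_set_mult[OF K(2) P(2) cop(2)]
  have "G'\<lparr>carrier := K' <#>\<^bsub>G'\<^esub> P'\<rparr> \<cong> G'\<lparr>carrier := K'\<rparr> \<times>\<times> G'\<lparr>carrier := P'\<rparr>"
    using group.iso_sym[OF DirProd_group[OF normal_imp_group[OF K(2)] normal_imp_group[OF P(2)]] 2(3)] .
  also have "\<dots> \<cong> G\<lparr>carrier := K\<rparr> \<times>\<times> G\<lparr>carrier := P\<rparr>"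
    using group.DirProd_iso_trans[OF normal_imp_group[OF K(2)] isoK isoP] .
  also have "\<dots> \<cong> G\<lparr>carrier := K <#>\<^bsub>G\<^esub> P\<rparr>" by (rule 1(3))
  finally show ?case
    using 1(1,2) 2(1,2) K P insert.hyps by (intro exI[of _ "K <#>\<^bsub>G\<^esub> P"] exI[of _ "K' <#>\<^bsub>G'\<^esub> P'"]) (simp add: mult.commute)
qed

lemma comm_group_DirProd: "comm_group G \<Longrightarrow> comm_group H \<Longrightarrow> comm_group (G \<times>\<times> H)"
  by (rule group.group_comm_groupI[OF DirProd_group])
     (auto simp: comm_group_def comm_monoid.m_comm)

text \<open>The same induction for a single group. It is applied to the odd primes, where the Sylow
  subgroups are symmetric and commutative because their orders divide p^2.\<close>

lemma symmetric_normal_hall: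
  assumes G: "group G"
    and S: "finite S" "\<And>p. p \<in> S \<Longrightarrow> Factorial_Ring.prime p"
    and syl: "\<And>p. p \<in> S \<Longrightarrow> \<exists>P. P \<lhd> G \<and> card P = p ^ e p
       \<and> zeta_symmetric (G\<lparr>carrier := P\<rparr>) \<and> comm_group (G\<lparr>carrier := P\<rparr>)"
  shows "\<exists>K. K \<lhd> G \<and> card K = (\<Prod>p\<in>S. p ^ e p)
       \<and> zeta_symmetric (G\<lparr>carrier := K\<rparr>) \<and> comm_group (G\<lparr>carrier := K\<rparr>)"
  using S syl
proof (induction S rule: finite_induct)
  case empty
  let ?T = "G\<lparr>carrier := {\<one>\<^bsub>G\<^esub>}\<rparr>"
  have T: "{\<one>\<^bsub>G\<^esub>} \<lhd> G" using G group.one_is_normal by blast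
  have "comm_group ?T" by (rule group.group_comm_groupI[OF normal_imp_group[OF T]]) auto
  moreover have "zeta_symmetric ?T"
    by (rule zeta_symmetricI[OF normal_imp_group[OF T]]) (auto simp: order_def)
  ultimately show ?case using T by auto
next
  case (insert p S)
  obtain K where K: "K \<lhd> G" "card K = (\<Prod>p\<in>S. p ^ e p)"
      and goodK: "zeta_symmetric (G\<lparr>carrier := K\<rparr>)" "comm_group (G\<lparr>carrier := K\<rparr>)"
    using insert.IH insert.prems by blast
  obtain P where P: "P \<lhd> G" "card P = p ^ e p"
      and goodP: "zeta_symmetric (G\<lparr>carrier := P\<rparr>)" "comm_group (G\<lparr>carrier := P\<rparr>)"
    using insert.prems by blast
  have cop: "coprime (card K) (card P)"
    unfolding K P by (rule coprime_prod_prime_powers) (use insert.hyps insert.prems(1) in auto)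
  note 1 = coprime_normal_set_mult[OF K(1) P(1) cop]
  note g = normal_imp_group[OF K(1)] normal_imp_group[OF P(1)] normal_imp_group[OF 1(1)]
  have "zeta_symmetric (G\<lparr>carrier := K\<rparr> \<times>\<times> G\<lparr>carrier := P\<rparr>)"
    using cop by (intro zeta_symmetric_DirProd g goodK goodP) (simp add: order_def)
  then have "zeta_symmetric (G\<lparr>carrier := K <#>\<^bsub>G\<^esub> P\<rparr>)"
    using zeta_symmetric_iso[OF DirProd_group[OF g(1,2)] g(3) 1(3)] by simp
  moreover have "comm_group (G\<lparr>carrier := K <#>\<^bsub>G\<^esub> P\<rparr>)"
    using comm_group_iso[OF comm_group_DirProd[OF goodK(2) goodP(2)] g(3) 1(3)] .
  ultimately show ?case using 1(1,2) K P insert.hyps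
    by (intro exI[of _ "K <#>\<^bsub>G\<^esub> P"]) (simp add: mult.commute)
qed

section \<open>Groups of order dividing the square of a prime\<close>

text \<open>A multiplication table \<open>m\<close> on \<open>I\<close>, realised by
  \<open>G\<close> through \<open>f\<close>. Groups over different types can share a table, and
  counting in \<open>G\<close> becomes a computation in \<open>I\<close>.\<close>

definition coordinates :: "('a, 'b) monoid_scheme \<Rightarrow> 'i set \<Rightarrow> ('i \<Rightarrow> 'i \<Rightarrow> 'i) \<Rightarrow> ('i \<Rightarrow> 'a) \<Rightarrow> bool" where
  "coordinates G I m f \<longleftrightarrow> bij_betw f I (carrier G) \<and>
     (\<forall>i\<in>I. \<forall>j\<in>I. m i j \<in> I \<and> f i \<otimes>\<^bsub>G\<^esub> f j = f (m i j))"

lemma iso_if_same_coordinates: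
  assumes f: "coordinates G I m f" and g: "coordinates H I m g"
  shows "G \<cong> H"
proof -
  define h where "h = g \<circ> inv_into I f"
  have hf: "h (f i) = g i" if "i \<in> I" for i
    using f that by (simp add: h_def coordinates_def bij_betw_def inv_into_f_f)
  have "bij_betw h (carrier G) (carrier H)"
    unfolding h_def using f g by (auto simp: coordinates_def intro: bij_betw_trans bij_betw_inv_into)
  moreover have "h \<in> hom G H"
  proof (rule homI)
    show "h x \<in> carrier H" if "x \<in> carrier G" for x
      using calculation that by (rule bij_betwE[rule_format])
    fix x y assume "x \<in> carrier G" "y \<in> carrier G"
    then obtain i j where ij: "i \<in> I" "j \<in> I" "x = f i" "y = f j"
      using f unfolding coordinates_def bij_betw_def by blast
    moreover have "m i j \<in> I" "f i \<otimes>\<^bsub>G\<^esub> f j = f (m i j)" "g i \<otimes>\<^bsub>H\<^esub> g j = g (m i j)"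
      using ij f g unfolding coordinates_def by blast+
    ultimately show "h (x \<otimes>\<^bsub>G\<^esub> y) = h x \<otimes>\<^bsub>H\<^esub> h y" by (simp add: hf)
  qed
  ultimately have "h \<in> iso G H" by (simp add: iso_def)
  then show ?thesis by (rule is_isoI)
qed

lemma coordinates_comm_iff:
  assumes G: "group G" and f: "coordinates G I m f"
  shows "comm_group G \<longleftrightarrow> (\<forall>i\<in>I. \<forall>j\<in>I. m i j = m j i)"
proof
  have inj: "inj_on f I" and img: "f ` I = carrier G" using f by (auto simp: coordinates_def bij_betw_def)
  have m: "m i j \<in> I" "f i \<otimes>\<^bsub>G\<^esub> f j = f (m i j)" if "i \<in> I" "j \<in> I" for i j
    using f that unfolding coordinates_def by blast+
  show "\<forall>i\<in>I. \<forall>j\<in>I. m i j = m j i" if "comm_group G"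
  proof (intro ballI)
    fix i j assume ij: "i \<in> I" "j \<in> I"
    then have "f i \<otimes>\<^bsub>G\<^esub> f j = f j \<otimes>\<^bsub>G\<^esub> f i"
      using that img by (intro comm_monoid.m_comm) (auto simp: comm_group_def)
    then show "m i j = m j i" using ij m inj by (metis inj_onD)
  qed
  show "comm_group G" if c: "\<forall>i\<in>I. \<forall>j\<in>I. m i j = m j i"
  proof (rule group.group_comm_groupI[OF G])
    fix x y assume "x \<in> carrier G" "y \<in> carrier G"
    then obtain i j where "i \<in> I" "j \<in> I" "x = f i" "y = f j" using img by blast
    then show "x \<otimes>\<^bsub>G\<^esub> y = y \<otimes>\<^bsub>G\<^esub> x" using m c by metis
  qed
qed

section \<open>Cyclic groups and groups of prime order\<close>

lemma (in group) coordinates_cyclic: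
  assumes fin: "finite (carrier G)" and x: "x \<in> carrier G" "ord x = order G"
  shows "coordinates G {..<order G} (\<lambda>i j. (i + j) mod order G) (\<lambda>i. x [^] i)"
proof -
  have o: "order G > 0" using fin order_gt_0_iff_finite by blast
  then have "{0..ord x - 1} = {..<order G}" using x by auto
  then have inj: "inj_on (\<lambda>i. x [^] i) {..<order G}" using ord_inj[OF x(1)] by simp
  then have "(\<lambda>i. x [^] i) ` {..<order G} = carrier G"
    using x fin by (intro card_subset_eq) (auto simp: card_image order_def)
  moreover have "x [^] i \<otimes> x [^] j = x [^] ((i + j) mod order G)" for i j
    using nat_pow_1_mod[OF group_axioms x(1), of "(i + j) mod order G" "i + j"] x(1)
    by (simp add: nat_pow_mult cong_def)
  ultimately show ?thesis using inj o by (auto simp: coordinates_def bij_betw_def)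
qed

lemma cyclic_iso:
  assumes "group G" "finite (carrier G)" "x \<in> carrier G" "group.ord G x = order G"
    and "group H" "finite (carrier H)" "y \<in> carrier H" "group.ord H y = order H" "order G = order H"
  shows "G \<cong> H"
  using assms group.coordinates_cyclic iso_if_same_coordinates by metis

lemma (in group) cyclic_comm:
  assumes "finite (carrier G)" "x \<in> carrier G" "ord x = order G"
  shows "comm_group G"
  using coordinates_comm_iff[OF group_axioms coordinates_cyclic[OF assms]] by (simp add: add.commute)

lemma (in group) subgroup_pow_card:
  assumes "subgroup H G" "h \<in> H" shows "h [^] card H = \<one>"
proof -
  interpret H: group "G\<lparr>carrier := H\<rparr>" using assms(1) by (rule subgroup_imp_group)
  show ?thesis using H.pow_order_eq_1[of h] assms(2) by (simp add: order_def flip: nat_pow_consistent)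
qed

text \<open>Every element \<open>h\<close> of a subgroup of order \<open>d\<close> satisfies
  \<open>h^d = 1\<close>. The solutions of this equation are the \<open>d\<close> powers of
  \<open>x^e\<close>, so the subgroup consists of all of them.\<close>

lemma (in group) cyclic_num_subgroups_le_1:
  assumes fin: "finite (carrier G)" and x: "x \<in> carrier G" "ord x = order G"
  shows "num_subgroups G d \<le> 1"
proof (cases "d dvd order G")
  case True
  then obtain e where e: "order G = e * d" by (metis dvd_div_mult_self)
  have o: "order G > 0" using fin order_gt_0_iff_finite by blast
  then have ed: "e > 0" "d > 0" using e by (auto intro: Nat.gr0I)
  let ?U = "(\<lambda>j. x [^] (e * j)) ` {..<d}"
  have "H = ?U" if H: "subgroup H G" "card H = d" for H
  proof (rule card_seteq)
    show "H \<subseteq> ?U"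
    proof
      fix h assume h: "h \<in> H"
      then have "h \<in> carrier G" using H subgroup.subset by blast
      then obtain i where i: "i < order G" "h = x [^] i"
        using coordinates_cyclic[OF fin x] unfolding coordinates_def bij_betw_def by blast
      have "x [^] (i * d) = \<one>" using subgroup_pow_card[OF H(1) h] H(2) i x by (simp add: nat_pow_pow)
      then have "e * d dvd i * d" using pow_eq_id x e by simp
      then obtain j where j: "i = e * j" using ed by (auto simp: dvd_def)
      then have "j < d" using i(1) e ed by simp
      then show "h \<in> ?U" using i j by blast
    qed
    show "card ?U \<le> card H" using card_image_le[of "{..<d}"] H by auto
  qed simp
  then have "{H. subgroup H G \<and> card H = d} \<subseteq> {?U}" by blast
  then show ?thesis unfolding num_subgroups_def by (metis card_mono card.empty card_insert_disjoint finite.emptyI finite_insert empty_iff One_nat_def)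
qed (simp add: num_subgroups_eq_0)

lemma (in group) num_subgroups_prime_power_pos:
  assumes "finite (carrier G)" "Factorial_Ring.prime p" "p ^ j dvd order G"
  shows "num_subgroups G (p ^ j) \<ge> 1"
proof -
  obtain m where "order G = p ^ j * m" using assms(3) by (auto simp: dvd_def)
  then obtain H where "subgroup H G" "card H = p ^ j" using sylow_thm[OF assms(2) group_axioms _ assms(1)] by blast
  then have "{H. subgroup H G \<and> card H = p ^ j} \<noteq> {}" by blast
  moreover have "finite {H. subgroup H G \<and> card H = p ^ j}"
    using finite_subgroups[OF assms(1)] by (rule rev_finite_subset) blast
  ultimately show ?thesis unfolding num_subgroups_def by (simp add: Suc_le_eq card_gt_0_iff)
qed

lemma (in group) prime_order_cyclic:
  assumes "Factorial_Ring.prime (order G)"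
  shows "\<exists>x \<in> carrier G. ord x = order G"
proof -
  have "order G > 1" using assms prime_gt_1_nat by blast
  then have "carrier G \<noteq> {\<one>}" by (auto simp: order_def)
  then obtain x where x: "x \<in> carrier G" "x \<noteq> \<one>" using one_closed by blast
  then have "ord x \<noteq> 1" using ord_eq_1 by blast
  then show ?thesis using x ord_dvd_group_order[OF x(1)] assms by (metis prime_nat_iff)
qed

lemma prime_order_iso:
  assumes "group G" "group H" "order G = order H" "Factorial_Ring.prime (order G)"
  shows "G \<cong> H"
proof -
  have "finite (carrier G)" "finite (carrier H)"
    using assms prime_gt_0_nat by (metis monoid.order_gt_0_iff_finite group.is_monoid)+
  then show ?thesis using assms group.prime_order_cyclic cyclic_iso by metis
qed

text \<open>Multiplication is injective on \<open>A \<times> B\<close> when the intersection is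
  trivial. The equality case produces direct decompositions; the bound shows that two large
  subgroups must meet.\<close>

lemma (in group) disjoint_subgroups_card:
  assumes fin: "finite (carrier G)" and A: "subgroup A G" and B: "subgroup B G" and triv: "A \<inter> B = {\<one>}"
  shows "card (A <#> B) = card A * card B" "card A * card B \<le> order G"
    "card A * card B = order G \<Longrightarrow> A <#> B = carrier G"
proof -
  have "group_disjoint_sum G A B" by (simp add: group_disjoint_sum_def group_axioms A B)
  from group_disjoint_sum.cancel[OF this] triv
  have "inj_on (\<lambda>(a, b). a \<otimes> b) (A \<times> B)" by (simp add: inj_on_def)
  moreover have img: "(\<lambda>(a, b). a \<otimes> b) ` (A \<times> B) = A <#> B" by (auto simp: set_mult_def)
  ultimately show 1: "card (A <#> B) = card A * card B"
    by (metis card_image card_cartesian_product)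
  have sub: "A <#> B \<subseteq> carrier G" using A B by (simp add: setmult_subset_G subgroup.subset)
  then show "card A * card B \<le> order G" using 1 fin by (metis card_mono order_def)
  show "card A * card B = order G \<Longrightarrow> A <#> B = carrier G"
    using 1 fin sub by (simp add: card_subset_eq order_def)
qed

lemma (in group) prime_subgroups_disjoint:
  assumes A: "subgroup A G" "card A = p" and B: "subgroup B G" "card B = p"
    and p: "Factorial_Ring.prime p" and ne: "A \<noteq> B"
  shows "A \<inter> B = {\<one>}"
proof -
  have AB: "subgroup (A \<inter> B) G" using subgroups_Inter_pair A(1) B(1) by blast
  interpret A: group "G\<lparr>carrier := A\<rparr>" using A(1) by (rule subgroup_imp_group)
  have fin: "finite A" "finite B" using A B p prime_gt_0_nat by (metis card_gt_0_iff)+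
  have "card (A \<inter> B) dvd p"
    using A.card_subgroup_dvd[OF subgroup_incl[OF AB A(1)]] A(2) by (simp add: order_def)
  moreover have "card (A \<inter> B) \<noteq> p"
  proof
    assume "card (A \<inter> B) = p"
    then have "A \<inter> B = A" "A \<inter> B = B"
      using card_subset_eq[OF fin(1) Int_lower1[of A B]] card_subset_eq[OF fin(2) Int_lower2[of A B]] A(2) B(2) by simp_all
    then show False using ne by blast
  qed
  ultimately have "card (A \<inter> B) = 1" using p by (metis prime_nat_iff)
  then show ?thesis using subgroup.one_closed[OF AB] by (metis card_1_singletonE singletonD)
qed

text \<open>Otherwise \<open>G\<close> would be the product of \<open>A\<close> and a conjugate of \<open>A\<close> by \<open>x\<close>; writing \<open>x\<close> itself as
  such a product gives \<open>x \<in> A\<close>.\<close>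

lemma (in group) prime_order_subgroup_normal:
  assumes p: "Factorial_Ring.prime p" and o: "order G = p * p" and A: "subgroup A G" "card A = p"
  shows "A \<lhd> G"
proof (rule normal_invI[OF A(1)])
  fix x h assume x: "x \<in> carrier G" and h: "h \<in> A"
  show "x \<otimes> h \<otimes> inv x \<in> A"
  proof (rule ccontr)
    assume n: "x \<otimes> h \<otimes> inv x \<notin> A"
    let ?B = "(\<lambda>h. x \<otimes> h \<otimes> inv x) ` A"
    have fin: "finite (carrier G)" using o p prime_gt_0_nat order_gt_0_iff_finite by simp
    note B = conjugate_subgroup[OF x A(1)]
    have "?B \<noteq> A" using n h by blast
    then have "?B \<inter> A = {\<one>}" using prime_subgroups_disjoint[OF B(1) _ A p] B(2) A(2) by simp
    then have "?B <#> A = carrier G" using disjoint_subgroups_card(3)[OF fin B(1) A(1)] B(2) A(2) o by simp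
    then obtain b a where ba: "b \<in> A" "a \<in> A" "x = x \<otimes> b \<otimes> inv x \<otimes> a"
      using x unfolding set_mult_def by blast
    then have car: "a \<in> carrier G" "b \<in> carrier G" using A(1) subgroup.subset by blast+
    have "x \<otimes> (b \<otimes> inv x \<otimes> a) = x \<otimes> b \<otimes> inv x \<otimes> a" using x car by (simp add: m_assoc)
    then have "x \<otimes> (b \<otimes> inv x \<otimes> a) = x" using ba(3) by (rule trans[OF _ sym])
    then have "b \<otimes> inv x \<otimes> a = \<one>" using x car by (simp only: l_cancel_one m_closed inv_closed)
    then have "inv a = b \<otimes> inv x" using x car by (intro inv_equality) auto
    then have "inv (inv a) = inv (b \<otimes> inv x)" by (rule arg_cong)
    then have "a = x \<otimes> inv b" using x car by (simp add: inv_mult_group)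
    then have "a \<otimes> b = x" using x car by (simp add: m_assoc)
    moreover have "a \<otimes> b \<in> A" using ba A(1) by (simp add: subgroup.m_closed)
    ultimately have "x \<in> A" by simp
    then show False using n h A(1) by (simp add: subgroup.m_closed subgroup.m_inv_closed)
  qed
qed

section \<open>Groups of order \<open>p * p\<close>\<close>

lemma (in group) generate_subgroup_of_order:
  assumes "x \<in> carrier G" shows "subgroup (generate G {x}) G" "card (generate G {x}) = ord x" "x \<in> generate G {x}"
  using assms generate_is_subgroup generate_pow_card by (auto intro: generate.incl)

text \<open>Every nontrivial element has order \<open>p\<close>. The subgroups generated by some
  \<open>x\<close> and by some \<open>y\<close> outside the first are distinct of order
  \<open>p\<close>, so they meet trivially and their product has \<open>p * p\<close>
  elements.\<close>

lemma (in group) noncyclic_prime_square: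
  assumes p: "Factorial_Ring.prime p" and o: "order G = p * p" and nc: "\<And>x. x \<in> carrier G \<Longrightarrow> ord x \<noteq> order G"
  shows "\<exists>A B. A \<lhd> G \<and> B \<lhd> G \<and> card A = p \<and> card B = p \<and> A \<inter> B = {\<one>} \<and> A <#> B = carrier G"
proof -
  have fin: "finite (carrier G)" using o p prime_gt_0_nat order_gt_0_iff_finite by simp
  have ordp: "ord x = p" if "x \<in> carrier G" "x \<noteq> \<one>" for x
  proof -
    have "ord x dvd p ^ 2" using ord_dvd_group_order[OF that(1)] o by (simp add: power2_eq_square)
    then obtain i where i: "i \<le> 2" "ord x = p ^ i" using p divides_primepow_nat by blast
    have "ord x \<noteq> 1" using that ord_eq_1 by blast
    then have "i \<noteq> 0" using i by auto
    moreover have "i \<noteq> 2" using i nc[OF that(1)] o by (auto simp: power2_eq_square)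
    ultimately have "i = 1" using i by simp
    then show ?thesis using i by simp
  qed
  have "p * p > 1" using p prime_gt_1_nat less_1_mult by blast
  then have "carrier G \<noteq> {\<one>}" using o by (auto simp: order_def)
  then obtain x where x: "x \<in> carrier G" "x \<noteq> \<one>" using one_closed by blast
  let ?A = "generate G {x}"
  have A: "subgroup ?A G" "card ?A = p" using generate_subgroup_of_order[OF x(1)] ordp[OF x] by auto
  have "p < p * p" using prime_gt_1_nat[OF p] by simp
  then have "?A \<noteq> carrier G" using A o by (auto simp: order_def)
  then obtain y where y: "y \<in> carrier G" "y \<notin> ?A" using A subgroup.subset by blast
  have y1: "y \<noteq> \<one>" using y A subgroup.one_closed by blast
  let ?B = "generate G {y}"
  have B: "subgroup ?B G" "card ?B = p" "y \<in> ?B" using generate_subgroup_of_order[OF y(1)] ordp[OF y(1) y1] by auto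
  have "?A \<noteq> ?B" using B(3) y by blast
  then have "?A \<inter> ?B = {\<one>}" using prime_subgroups_disjoint[OF A B(1,2) p] by blast
  moreover from this have "?A <#> ?B = carrier G" using disjoint_subgroups_card(3)[OF fin A(1) B(1)] A B o by simp
  ultimately show ?thesis using prime_order_subgroup_normal[OF p o] A B by blast
qed

lemma (in group) internal_direct_product_whole_iso:
  assumes "A \<lhd> G" "B \<lhd> G" "A \<inter> B = {\<one>}" "A <#> B = carrier G"
  shows "G\<lparr>carrier := A\<rparr> \<times>\<times> G\<lparr>carrier := B\<rparr> \<cong> G" "G \<cong> G\<lparr>carrier := A\<rparr> \<times>\<times> G\<lparr>carrier := B\<rparr>"
proof -
  show 1: "G\<lparr>carrier := A\<rparr> \<times>\<times> G\<lparr>carrier := B\<rparr> \<cong> G"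
    using internal_direct_product_iso[OF assms(1-3)] assms(4) by simp
  show "G \<cong> G\<lparr>carrier := A\<rparr> \<times>\<times> G\<lparr>carrier := B\<rparr>"
    using group.iso_sym[OF DirProd_group[OF normal_imp_group[OF assms(1)] normal_imp_group[OF assms(2)]] 1] .
qed

lemma prime_square_comm:
  assumes G: "group G" and p: "Factorial_Ring.prime p" and o: "order G = p * p"
  shows "comm_group G"
proof -
  interpret group G by fact
  have fin: "finite (carrier G)" using o p prime_gt_0_nat order_gt_0_iff_finite by simp
  show ?thesis
  proof (cases "\<exists>x \<in> carrier G. ord x = order G")
    case False
    then obtain A B where AB: "A \<lhd> G" "B \<lhd> G" "card A = p" "card B = p" "A \<inter> B = {\<one>\<^bsub>G\<^esub>}" "A <#>\<^bsub>G\<^esub> B = carrier G"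
      using noncyclic_prime_square[OF p o] by blast
    have cyc: "comm_group (G\<lparr>carrier := C\<rparr>)" if "C \<lhd> G" "card C = p" for C
    proof -
      interpret C: group "G\<lparr>carrier := C\<rparr>" using that(1) by (rule normal_imp_group)
      have "finite C" using that(2) p prime_gt_0_nat by (metis card_gt_0_iff)
      then show ?thesis using C.prime_order_cyclic C.cyclic_comm that p by (auto simp: order_def)
    qed
    show ?thesis
      using comm_group_iso[OF comm_group_DirProd[OF cyc cyc] G internal_direct_product_whole_iso(1)[OF AB(1,2,5,6)]] AB by blast
  qed (use cyclic_comm fin in blast)
qed

lemma noncyclic_prime_square_iso:
  assumes p: "Factorial_Ring.prime p"
    and G: "group G" "order G = p * p" "\<And>x. x \<in> carrier G \<Longrightarrow> group.ord G x \<noteq> order G"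
    and H: "group H" "order H = p * p" "\<And>x. x \<in> carrier H \<Longrightarrow> group.ord H x \<noteq> order H"
  shows "G \<cong> H"
proof -
  obtain A B where AB: "A \<lhd> G" "B \<lhd> G" "card A = p" "card B = p" "A \<inter> B = {\<one>\<^bsub>G\<^esub>}" "A <#>\<^bsub>G\<^esub> B = carrier G"
    using group.noncyclic_prime_square[OF G(1) p G(2,3)] by blast
  obtain C D where CD: "C \<lhd> H" "D \<lhd> H" "card C = p" "card D = p" "C \<inter> D = {\<one>\<^bsub>H\<^esub>}" "C <#>\<^bsub>H\<^esub> D = carrier H"
    using group.noncyclic_prime_square[OF H(1) p H(2,3)] by blast
  have "G \<cong> G\<lparr>carrier := A\<rparr> \<times>\<times> G\<lparr>carrier := B\<rparr>"
    using group.internal_direct_product_whole_iso(2)[OF G(1) AB(1,2,5,6)] .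
  also have "\<dots> \<cong> H\<lparr>carrier := C\<rparr> \<times>\<times> H\<lparr>carrier := D\<rparr>"
    by (rule group.DirProd_iso_trans[OF normal_imp_group[OF AB(1)]];
        rule prime_order_iso) (use AB CD p normal_imp_group in \<open>auto simp: order_def\<close>)
  also have "\<dots> \<cong> H" using group.internal_direct_product_whole_iso(1)[OF H(1) CD(1,2,5,6)] .
  finally show ?thesis .
qed

text \<open>The exact number is p + 1; the bound 2 already separates this case from the cyclic
  one.\<close>

lemma (in group) noncyclic_prime_square_num_subgroups:
  assumes p: "Factorial_Ring.prime p" and o: "order G = p * p" and nc: "\<And>x. x \<in> carrier G \<Longrightarrow> ord x \<noteq> order G"
  shows "num_subgroups G p \<ge> 2"
proof -
  have fin: "finite (carrier G)" using o p prime_gt_0_nat order_gt_0_iff_finite by simp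
  obtain A B where AB: "A \<lhd> G" "B \<lhd> G" "card A = p" "card B = p" "A \<inter> B = {\<one>}"
    using noncyclic_prime_square[OF p o nc] by blast
  have "A \<noteq> B" using AB p prime_gt_1_nat by (metis Int_absorb One_nat_def card.empty card_insert_disjoint empty_iff finite.emptyI less_irrefl)
  then have "2 = card {A, B}" by simp
  also have "\<dots> \<le> num_subgroups G p"
    unfolding num_subgroups_def
    using AB finite_subgroups[OF fin] by (intro card_mono) (auto simp: normal_def)
  finally show ?thesis .
qed

lemma (in group) order_prime_power_le_2_cases:
  assumes p: "Factorial_Ring.prime p" and o: "order G = p ^ k" "k \<le> 2"
  obtains x where "x \<in> carrier G" "ord x = order G"
  | "order G = p * p" "\<And>x. x \<in> carrier G \<Longrightarrow> ord x \<noteq> order G"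
proof -
  consider "k = 0" | "k = 1" | "k = 2" using o by linarith
  then show ?thesis
  proof cases
    case 1
    then show ?thesis using that(1)[of \<one>] o ord_id by simp
  next
    case 2
    then show ?thesis using that(1) prime_order_cyclic o p by auto
  next
    case 3
    then show ?thesis using that o by (auto simp: power2_eq_square)
  qed
qed

lemma prime_power_le_2_comm:
  assumes G: "group G" and p: "Factorial_Ring.prime p" and o: "order G = p ^ k" "k \<le> 2"
  shows "comm_group G"
proof -
  interpret group G by fact
  have fin: "finite (carrier G)" using o p prime_gt_0_nat order_gt_0_iff_finite by simp
  show ?thesis
    by (rule order_prime_power_le_2_cases[OF p o]) (use cyclic_comm[OF fin] prime_square_comm[OF G p] in blast)+
qed

lemma prime_power_le_2_iso:
  assumes p: "Factorial_Ring.prime p"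
    and G: "group G" "order G = p ^ k" and H: "group H" "order H = p ^ k" and k: "k \<le> 2"
    and eq: "num_subgroups G p = num_subgroups H p"
  shows "G \<cong> H"
proof -
  have fin: "finite (carrier G)" "finite (carrier H)"
    using G H p prime_gt_0_nat by (metis monoid.order_gt_0_iff_finite group.is_monoid zero_less_power)+
  show ?thesis
  proof (rule group.order_prime_power_le_2_cases[OF G(1) p G(2) k]; rule group.order_prime_power_le_2_cases[OF H(1) p H(2) k])
    fix x y assume "x \<in> carrier G" "group.ord G x = order G" "y \<in> carrier H" "group.ord H y = order H"
    then show ?thesis using cyclic_iso[OF G(1) fin(1) _ _ H(1) fin(2)] G H by metis
  next
    fix x assume "x \<in> carrier G" "group.ord G x = order G" and H': "order H = p * p" "\<And>y. y \<in> carrier H \<Longrightarrow> group.ord H y \<noteq> order H"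
    then have "num_subgroups G p \<le> 1" using group.cyclic_num_subgroups_le_1[OF G(1) fin(1)] by blast
    then show ?thesis using group.noncyclic_prime_square_num_subgroups[OF H(1) p H'] eq by simp
  next
    fix y assume G': "order G = p * p" "\<And>x. x \<in> carrier G \<Longrightarrow> group.ord G x \<noteq> order G" and "y \<in> carrier H" "group.ord H y = order H"
    then have "num_subgroups H p \<le> 1" using group.cyclic_num_subgroups_le_1[OF H(1) fin(2)] by blast
    then show ?thesis using group.noncyclic_prime_square_num_subgroups[OF G(1) p G'] eq by simp
  next
    assume "order G = p * p" "\<And>x. x \<in> carrier G \<Longrightarrow> group.ord G x \<noteq> order G"
      "order H = p * p" "\<And>y. y \<in> carrier H \<Longrightarrow> group.ord H y \<noteq> order H"
    then show ?thesis by (rule noncyclic_prime_square_iso[OF p G(1) _ _ H(1)])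
  qed
qed

text \<open>The counts at 1 and at the order are both 1, and in order p^2 the remaining divisor
  \<open>p\<close> is its own complement.\<close>

lemma prime_power_le_2_symmetric:
  assumes G: "group G" and p: "Factorial_Ring.prime p" and o: "order G = p ^ k" "k \<le> 2"
  shows "zeta_symmetric G"
proof -
  interpret group G by fact
  have fin: "finite (carrier G)" using o p prime_gt_0_nat order_gt_0_iff_finite by simp
  have p0: "p > 0" using p prime_gt_0_nat by blast
  show ?thesis
  proof (rule zeta_symmetricI[OF G fin])
    fix d assume "d dvd order G"
    then obtain i where i: "i \<le> k" "d = p ^ i" using o p divides_primepow_nat by metis
    consider "i = 0" | "i = k" | "i = 1" "k = 2" using i o(2) by linarith
    then show "num_subgroups G d = num_subgroups G (order G div d)"
    proof cases
      case 1
      then show ?thesis using i num_subgroups_1 num_subgroups_order[OF fin] by simp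
    next
      case 2
      then have "order G div d = 1" using i o p0 by simp
      then show ?thesis using 2 i o num_subgroups_1 num_subgroups_order[OF fin] by simp
    next
      case 3
      then have "order G div d = d" using i o p0 by (simp add: power2_eq_square)
      then show ?thesis by simp
    qed
  qed
qed

section \<open>Groups of order 8\<close>

text \<open>A subgroup of order 2 is determined by its nontrivial element, so counting these
  subgroups is counting involutions.\<close>

lemma (in group) num_subgroups_2:
  "num_subgroups G 2 = card {g \<in> carrier G. g \<noteq> \<one> \<and> g \<otimes> g = \<one>}"
proof -
  have "bij_betw (\<lambda>g. {\<one>, g}) {g \<in> carrier G. g \<noteq> \<one> \<and> g \<otimes> g = \<one>} {H. subgroup H G \<and> card H = 2}"
  proof (rule bij_betw_imageI)
    show "inj_on (\<lambda>g. {\<one>, g}) {g \<in> carrier G. g \<noteq> \<one> \<and> g \<otimes> g = \<one>}"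
      by (auto simp: inj_on_def doubleton_eq_iff)
    show "(\<lambda>g. {\<one>, g}) ` {g \<in> carrier G. g \<noteq> \<one> \<and> g \<otimes> g = \<one>} = {H. subgroup H G \<and> card H = 2}"
    proof (intro equalityI subsetI)
      fix H assume "H \<in> (\<lambda>g. {\<one>, g}) ` {g \<in> carrier G. g \<noteq> \<one> \<and> g \<otimes> g = \<one>}"
      then obtain g where g: "g \<in> carrier G" "g \<noteq> \<one>" "g \<otimes> g = \<one>" "H = {\<one>, g}" by blast
      then have "subgroup H G" by (auto intro!: subgroupI simp: inv_equality)
      then show "H \<in> {H. subgroup H G \<and> card H = 2}" using g by simp
    next
      fix H assume "H \<in> {H. subgroup H G \<and> card H = 2}"
      then have H: "subgroup H G" "card H = 2" by auto
      then obtain a b where ab: "H = {a, b}" "a \<noteq> b" by (auto simp: card_2_iff)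
      have "\<one> \<in> H" using H(1) by (rule subgroup.one_closed)
      then obtain g where g: "H = {\<one>, g}" "g \<noteq> \<one>" using ab by auto
      have gG: "g \<in> carrier G" using H(1) g subgroup.subset by blast
      have "g \<in> H" using g by simp
      then have "g \<otimes> g \<in> H" using subgroup.m_closed[OF H(1)] by blast
      moreover have "g \<otimes> g \<noteq> g" using gG g by simp
      ultimately have "g \<otimes> g = \<one>" using g by blast
      then show "H \<in> (\<lambda>g. {\<one>, g}) ` {g \<in> carrier G. g \<noteq> \<one> \<and> g \<otimes> g = \<one>}" using g gG by blast
    qed
  qed
  then show ?thesis unfolding num_subgroups_def by (simp add: bij_betw_same_card)
qed

text \<open>The sets \<open>H - {\<one>, z}\<close> partition the six elements outside \<open>{\<one>, z}\<close> into pairs.\<close>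

lemma (in group) card_order_4_subgroups_containing:
  assumes o: "order G = 8" and z: "z \<in> carrier G" "z \<noteq> \<one>"
    and central: "\<And>g. g \<in> carrier G \<Longrightarrow> z \<otimes> g = g \<otimes> z"
    and sq: "\<And>g. g \<in> carrier G \<Longrightarrow> g \<otimes> g \<in> {\<one>, z}"
  shows "card {H. subgroup H G \<and> card H = 4 \<and> z \<in> H} = 3"
proof -
  let ?F = "{H. subgroup H G \<and> card H = 4 \<and> z \<in> H}"
  have fin: "finite (carrier G)" using o order_gt_0_iff_finite by simp
  have zz: "z \<otimes> z = \<one>"
  proof -
    have "z \<otimes> z \<noteq> z" using z by simp
    then show ?thesis using sq[OF z(1)] by blast
  qed
  have zzg: "z \<otimes> (z \<otimes> g) = g" if "g \<in> carrier G" for g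
    using zz z that by (simp flip: m_assoc)
  \<comment> \<open>The only candidate for a subgroup of order 4 containing \<open>z\<close> and
    \<open>g\<close>; it is closed because \<open>z\<close> is central and squares lie in
    \<open>{\<one>, z}\<close>.\<close>
  define S where "S g = {\<one>, z, g, z \<otimes> g}" for g
  have cardS: "card (S g) = 4" if g: "g \<in> carrier G - {\<one>, z}" for g
  proof -
    have "z \<otimes> g \<noteq> \<one>" using zzg[of g] g z by auto
    moreover have "z \<otimes> g \<noteq> z" "z \<otimes> g \<noteq> g" using g z by auto
    ultimately show ?thesis using g z unfolding S_def by auto
  qed
  have subS: "subgroup (S g) G" if g: "g \<in> carrier G - {\<one>, z}" for g
  proof (rule subgroup_if_finite_mult_closed[OF fin])
    have gG: "g \<in> carrier G" using g by blast
    show "S g \<subseteq> carrier G" "S g \<noteq> {}" using gG z by (auto simp: S_def)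
    have gz: "g \<otimes> z = z \<otimes> g" using central[OF gG] by simp
    have gzg: "g \<otimes> (z \<otimes> g) = z \<otimes> (g \<otimes> g)" using gG z gz by (simp flip: m_assoc)
    have zgz: "(z \<otimes> g) \<otimes> z = g" using gG z gz zzg by (simp add: m_assoc)
    have zgg: "(z \<otimes> g) \<otimes> g = z \<otimes> (g \<otimes> g)" using gG z by (simp add: m_assoc)
    have zgzg: "(z \<otimes> g) \<otimes> (z \<otimes> g) = g \<otimes> g" using gG z gzg zzg by (simp add: m_assoc)
    have zgg': "z \<otimes> (g \<otimes> g) \<in> {\<one>, z}" "g \<otimes> g \<in> {\<one>, z}" using sq[OF gG] zz z by auto
    fix x y assume "x \<in> S g" "y \<in> S g"
    then have "x \<otimes> y \<in> {\<one>, z, g, z \<otimes> g, g \<otimes> g, z \<otimes> (g \<otimes> g)}"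
      unfolding S_def using gG z zz zzg gz gzg zgz zgg zgzg by auto
    then show "x \<otimes> y \<in> S g" using zgg' unfolding S_def by auto
  qed
  have eqS: "H = S g" if H: "H \<in> ?F" and g: "g \<in> H - {\<one>, z}" for H g
  proof -
    have gG: "g \<in> carrier G - {\<one>, z}" using H g subgroup.subset by blast
    have "S g \<subseteq> H" using H g by (auto simp: S_def subgroup.one_closed subgroup.m_closed)
    moreover have "finite H" using H by (auto intro: card_ge_0_finite)
    ultimately have "S g = H" using H cardS[OF gG] by (intro card_subset_eq) auto
    then show ?thesis by simp
  qed
  have "card (\<Union>H\<in>?F. H - {\<one>, z}) = (\<Sum>H\<in>?F. card (H - {\<one>, z}))"
  proof (rule card_UN_disjoint)
    show "finite ?F" using finite_subgroups[OF fin] by (rule rev_finite_subset) blast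
    show "\<forall>H\<in>?F. finite (H - {\<one>, z})" by (auto intro: card_ge_0_finite)
    show "\<forall>H\<in>?F. \<forall>K\<in>?F. H \<noteq> K \<longrightarrow> (H - {\<one>, z}) \<inter> (K - {\<one>, z}) = {}"
    proof (intro ballI impI)
      fix H K assume "H \<in> ?F" "K \<in> ?F" "H \<noteq> K"
      then show "(H - {\<one>, z}) \<inter> (K - {\<one>, z}) = {}" using eqS by blast
    qed
  qed
  also have "\<dots> = (\<Sum>H\<in>?F. 2)"
  proof (rule sum.cong[OF refl])
    fix H assume H: "H \<in> ?F"
    then have "{\<one>, z} \<subseteq> H" using subgroup.one_closed by blast
    then show "card (H - {\<one>, z}) = 2" using H z by (simp add: card_Diff_subset)
  qed
  also have "(\<Union>H\<in>?F. H - {\<one>, z}) = carrier G - {\<one>, z}"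
  proof
    show "(\<Union>H\<in>?F. H - {\<one>, z}) \<subseteq> carrier G - {\<one>, z}" using subgroup.subset by blast
    show "carrier G - {\<one>, z} \<subseteq> (\<Union>H\<in>?F. H - {\<one>, z})"
    proof
      fix g assume g: "g \<in> carrier G - {\<one>, z}"
      then have "S g \<in> ?F" "g \<in> S g - {\<one>, z}" using subS cardS by (auto simp: S_def)
      then show "g \<in> (\<Union>H\<in>?F. H - {\<one>, z})" by blast
    qed
  qed
  finally have "card (carrier G - {\<one>, z}) = 2 * card ?F" by simp
  moreover have "card (carrier G - {\<one>, z}) = 6" using o z by (simp add: card_Diff_subset order_def)
  ultimately show ?thesis by simp
qed

lemma (in group) exponent_2_order_8:
  assumes o: "order G = 8" and sq: "\<And>g. g \<in> carrier G \<Longrightarrow> g \<otimes> g = \<one>"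
  shows "num_subgroups G 2 = 7" "num_subgroups G 4 = 7" "comm_group G"
proof -
  have fin: "finite (carrier G)" using o order_gt_0_iff_finite by simp
  have inv: "inv g = g" if "g \<in> carrier G" for g using sq that by (simp add: inv_equality)
  show comm: "comm_group G"
  proof (rule group_comm_groupI)
    fix x y assume xy: "x \<in> carrier G" "y \<in> carrier G"
    then have "inv (x \<otimes> y) = inv y \<otimes> inv x" by (rule inv_mult_group)
    then show "x \<otimes> y = y \<otimes> x" using xy inv by simp
  qed
  have T: "card (carrier G - {\<one>}) = 7" using o fin by (simp add: card_Diff_subset order_def)
  have "{g \<in> carrier G. g \<noteq> \<one> \<and> g \<otimes> g = \<one>} = carrier G - {\<one>}" using sq by blast
  then show "num_subgroups G 2 = 7" using T num_subgroups_2 by simp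
  let ?F = "{H. subgroup H G \<and> card H = 4}"
  \<comment> \<open>Double counting of pairs \<open>z \<in> H\<close>: each of the 7 involutions
    lies in 3 subgroups of order 4, and each such subgroup contains 3 involutions.\<close>
  have "(\<Sum>z\<in>carrier G - {\<one>}. card {H\<in>?F. z \<in> H}) = 3 * card ?F"
  proof (rule sum_multicount)
    show "finite ?F" using finite_subgroups[OF fin] by (rule rev_finite_subset) blast
    show "\<forall>H\<in>?F. card {z \<in> carrier G - {\<one>}. z \<in> H} = 3"
    proof
      fix H assume H: "H \<in> ?F"
      then have "{z \<in> carrier G - {\<one>}. z \<in> H} = H - {\<one>}" using subgroup.subset by blast
      then show "card {z \<in> carrier G - {\<one>}. z \<in> H} = 3"
        using H by (simp add: subgroup.one_closed card_Diff_subset)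
    qed
  qed (use fin in simp)
  moreover have "card {H\<in>?F. z \<in> H} = 3" if z: "z \<in> carrier G - {\<one>}" for z
  proof -
    have "z \<otimes> g = g \<otimes> z" if "g \<in> carrier G" for g
      using comm that z by (intro comm_monoid.m_comm) (auto simp: comm_group_def)
    then show ?thesis using card_order_4_subgroups_containing[OF o, of z] z sq by (simp add: conj_assoc)
  qed
  ultimately have "3 * 7 = 3 * card ?F" using T by simp
  then show "num_subgroups G 4 = 7" by (simp add: num_subgroups_def)
qed

text \<open>Split off a factor of order 2, generated by an involution \<open>z\<close> outside a
  subgroup \<open>A\<close> of order 4. As \<open>A\<close> has exponent 2 it is not cyclic, so the
  classification of order \<open>p * p\<close> with \<open>p = 2\<close> identifies it.\<close>

lemma exponent_2_order_8_iso:
  assumes G: "group G" "order G = 8" "\<And>g. g \<in> carrier G \<Longrightarrow> g \<otimes>\<^bsub>G\<^esub> g = \<one>\<^bsub>G\<^esub>"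
    and H: "group H" "order H = 8" "\<And>g. g \<in> carrier H \<Longrightarrow> g \<otimes>\<^bsub>H\<^esub> g = \<one>\<^bsub>H\<^esub>"
  shows "G \<cong> H"
proof -
  have split: "\<exists>A B. A \<lhd> K \<and> B \<lhd> K \<and> card A = 4 \<and> card B = 2 \<and> A \<inter> B = {\<one>\<^bsub>K\<^esub>} \<and> A <#>\<^bsub>K\<^esub> B = carrier K
      \<and> (\<forall>x\<in>A. group.ord (K\<lparr>carrier := A\<rparr>) x \<noteq> order (K\<lparr>carrier := A\<rparr>))"
    if K: "group K" "order K = 8" "\<And>g. g \<in> carrier K \<Longrightarrow> g \<otimes>\<^bsub>K\<^esub> g = \<one>\<^bsub>K\<^esub>" for K :: "('x, 'y) monoid_scheme"
  proof -
    interpret comm_group K using group.exponent_2_order_8(3)[OF K] .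
    have fin: "finite (carrier K)" using K(2) order_gt_0_iff_finite by simp
    obtain A where A: "subgroup A K" "card A = 2 ^ 2"
      using sylow_thm[of 2 K 2 2] K fin two_is_prime_nat by auto
    have "A \<noteq> carrier K" using A K(2) by (auto simp: order_def)
    then obtain z where z: "z \<in> carrier K" "z \<notin> A" using A subgroup.subset by blast
    let ?B = "generate K {z}"
    have "z \<noteq> \<one>\<^bsub>K\<^esub>" using z A subgroup.one_closed by blast
    moreover have "ord z dvd 2" using pow_eq_id[OF z(1), of 2] K(3)[OF z(1)] z by (simp add: numeral_2_eq_2)
    ultimately have ord: "ord z = 2" using z ord_eq_1 two_is_prime_nat by (metis prime_nat_iff)
    have B: "subgroup ?B K" "card ?B = 2" using generate_subgroup_of_order[OF z(1)] ord by auto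
    have AB: "A \<inter> ?B = {\<one>\<^bsub>K\<^esub>}"
    proof -
      have "{\<one>\<^bsub>K\<^esub>, z} \<subseteq> ?B" using B(1) subgroup.one_closed generate_subgroup_of_order[OF z(1)] by auto
      moreover have "finite ?B" using B(2) by (auto intro: card_ge_0_finite)
      ultimately have "{\<one>\<^bsub>K\<^esub>, z} = ?B" using B(2) \<open>z \<noteq> \<one>\<^bsub>K\<^esub>\<close> by (intro card_subset_eq) auto
      then show ?thesis using z(2) subgroup.one_closed[OF A(1)] by blast
    qed
    moreover have "A <#>\<^bsub>K\<^esub> ?B = carrier K"
      using disjoint_subgroups_card(3)[OF fin A(1) B(1) AB] A B K(2) by simp
    moreover have "group.ord (K\<lparr>carrier := A\<rparr>) x \<noteq> order (K\<lparr>carrier := A\<rparr>)" if x: "x \<in> A" for x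
    proof -
      interpret A: group "K\<lparr>carrier := A\<rparr>" using A(1) by (rule subgroup_imp_group)
      have xK: "x \<in> carrier K" using x A subgroup.subset by blast
      have "x [^]\<^bsub>K\<lparr>carrier := A\<rparr>\<^esub> (2::nat) = \<one>\<^bsub>K\<^esub>"
        using K(3)[OF xK] xK by (simp add: numeral_2_eq_2)
      then have "A.ord x dvd 2" using A.pow_eq_id[of x 2] x by simp
      then have "A.ord x \<le> 2" by (simp add: dvd_imp_le)
      then show ?thesis using A(2) by (simp add: order_def)
    qed
    ultimately show ?thesis using A B subgroup_imp_normal by (intro exI[of _ A] exI[of _ ?B]) simp
  qed
  obtain A B where AB: "A \<lhd> G" "B \<lhd> G" "card A = 4" "card B = 2" "A \<inter> B = {\<one>\<^bsub>G\<^esub>}" "A <#>\<^bsub>G\<^esub> B = carrier G"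
    "\<forall>x\<in>A. group.ord (G\<lparr>carrier := A\<rparr>) x \<noteq> order (G\<lparr>carrier := A\<rparr>)"
    using split[OF G] by blast
  obtain C D where CD: "C \<lhd> H" "D \<lhd> H" "card C = 4" "card D = 2" "C \<inter> D = {\<one>\<^bsub>H\<^esub>}" "C <#>\<^bsub>H\<^esub> D = carrier H"
    "\<forall>x\<in>C. group.ord (H\<lparr>carrier := C\<rparr>) x \<noteq> order (H\<lparr>carrier := C\<rparr>)"
    using split[OF H] by blast
  have AC: "G\<lparr>carrier := A\<rparr> \<cong> H\<lparr>carrier := C\<rparr>"
    by (rule noncyclic_prime_square_iso[OF two_is_prime_nat])
       (use AB(3,7) CD(3,7) normal_imp_group[OF AB(1)] normal_imp_group[OF CD(1)] in \<open>auto simp: order_def\<close>)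
  have BD: "G\<lparr>carrier := B\<rparr> \<cong> H\<lparr>carrier := D\<rparr>"
    by (rule prime_order_iso)
       (use AB(4) CD(4) normal_imp_group[OF AB(2)] normal_imp_group[OF CD(2)] two_is_prime_nat in \<open>auto simp: order_def\<close>)
  have "G \<cong> G\<lparr>carrier := A\<rparr> \<times>\<times> G\<lparr>carrier := B\<rparr>"
    using group.internal_direct_product_whole_iso(2)[OF G(1) AB(1,2,5,6)] .
  also have "\<dots> \<cong> H\<lparr>carrier := C\<rparr> \<times>\<times> H\<lparr>carrier := D\<rparr>"
    by (rule group.DirProd_iso_trans[OF normal_imp_group[OF AB(1)] AC BD])
  also have "\<dots> \<cong> H" using group.internal_direct_product_whole_iso(1)[OF H(1) CD(1,2,5,6)] .
  finally show ?thesis .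
qed

section \<open>Noncyclic groups of order 8 with an element of order 4\<close>

text \<open>The pair \<open>(i, j)\<close> stands for \<open>x\<^sup>i y\<^sup>j\<close>, where \<open>x\<close> has order 4, \<open>y x = x\<^sup>r y\<close> and \<open>y\<^sup>2 = x\<^sup>s\<close>. The
  parameters \<open>(r, s)\<close> in \<open>metacyclic_params\<close> give \<open>C\<^sub>4 \<times> C\<^sub>2\<close>, the dihedral and the quaternion group.\<close>

definition metacyclic_index :: "(nat \<times> nat) set" where "metacyclic_index = {..<4} \<times> {..<2}"

definition metacyclic_mult :: "nat \<Rightarrow> nat \<Rightarrow> nat \<times> nat \<Rightarrow> nat \<times> nat \<Rightarrow> nat \<times> nat" where
  "metacyclic_mult r s u v = ((fst u + r ^ snd u * fst v + (if snd u = 1 \<and> snd v = 1 then s else 0)) mod 4,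
     (snd u + snd v) mod 2)"

lemma metacyclic_index_eq: "metacyclic_index = {(0,0),(1,0),(2,0),(3,0),(0,1),(1,1),(2,1),(3,1)}"
  by (auto simp: metacyclic_index_def lessThan_nat_numeral lessThan_Suc)

text \<open>Besides \<open>(2, 0)\<close>, the candidates are the pairs \<open>(i, 1)\<close>, whose
  square has first coordinate \<open>(1 + r) * i + s\<close> modulo 4: it is zero for even
  \<open>i\<close>, for all \<open>i\<close>, and for no \<open>i\<close>, respectively.\<close>

lemma metacyclic_involutions:
  "card {u \<in> metacyclic_index. u \<noteq> (0,0) \<and> metacyclic_mult 1 0 u u = (0,0)} = 3"
  "card {u \<in> metacyclic_index. u \<noteq> (0,0) \<and> metacyclic_mult 3 0 u u = (0,0)} = 5"
  "card {u \<in> metacyclic_index. u \<noteq> (0,0) \<and> metacyclic_mult 3 2 u u = (0,0)} = 1"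
proof -
  have "{u \<in> metacyclic_index. u \<noteq> (0,0) \<and> metacyclic_mult 1 0 u u = (0,0)} = {(2,0),(0,1),(2,1)}"
    by (auto simp: metacyclic_index_eq metacyclic_mult_def dest: dvd_imp_le)
  then show "card {u \<in> metacyclic_index. u \<noteq> (0,0) \<and> metacyclic_mult 1 0 u u = (0,0)} = 3" by simp
  have "{u \<in> metacyclic_index. u \<noteq> (0,0) \<and> metacyclic_mult 3 0 u u = (0,0)} = {(2,0),(0,1),(1,1),(2,1),(3,1)}"
    by (auto simp: metacyclic_index_eq metacyclic_mult_def dest: dvd_imp_le)
  then show "card {u \<in> metacyclic_index. u \<noteq> (0,0) \<and> metacyclic_mult 3 0 u u = (0,0)} = 5" by simp
  have "{u \<in> metacyclic_index. u \<noteq> (0,0) \<and> metacyclic_mult 3 2 u u = (0,0)} = {(2,0)}"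
    by (auto simp: metacyclic_index_eq metacyclic_mult_def dest: dvd_imp_le)
  then show "card {u \<in> metacyclic_index. u \<noteq> (0,0) \<and> metacyclic_mult 3 2 u u = (0,0)} = 1" by simp
qed

definition metacyclic_params :: "(nat \<times> nat) set" where "metacyclic_params = {(1,0),(3,0),(3,2)}"

text \<open>For order 4: \<open>z = f (2, 0)\<close> is central and all squares lie in
  \<open>{\<one>, z}\<close>, so three subgroups of order 4 contain \<open>z\<close>. There are no
  others: a subgroup of order 4 avoiding \<open>z\<close> would meet the cyclic subgroup
  \<open>?A\<close> trivially, and the product would have 16 elements.\<close>

lemma (in group) metacyclic_num_subgroups:
  assumes rs: "(r, s) \<in> metacyclic_params" and f: "coordinates G metacyclic_index (metacyclic_mult r s) f"
  shows "num_subgroups G 2 = card {u \<in> metacyclic_index. u \<noteq> (0,0) \<and> metacyclic_mult r s u u = (0,0)}"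
    "num_subgroups G 4 = 3"
proof -
  have inj: "inj_on f metacyclic_index" and img: "f ` metacyclic_index = carrier G" using f by (auto simp: coordinates_def bij_betw_def)
  have m: "metacyclic_mult r s u v \<in> metacyclic_index" "f u \<otimes> f v = f (metacyclic_mult r s u v)" if "u \<in> metacyclic_index" "v \<in> metacyclic_index" for u v
    using f that unfolding coordinates_def by blast+
  have idx: "(0,0) \<in> metacyclic_index" "(1,0) \<in> metacyclic_index" "(2,0) \<in> metacyclic_index" "(3,0) \<in> metacyclic_index" by (simp_all add: metacyclic_index_eq)
  have fG: "f u \<in> carrier G" if "u \<in> metacyclic_index" for u using img that by blast
  have "f (0,0) \<otimes> f (0,0) = f (0,0)" using m(2)[OF idx(1) idx(1)] by (simp add: metacyclic_mult_def)
  then have f0: "f (0,0) = \<one>" using fG[OF idx(1)] by simp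
  have f1: "f u = \<one> \<longleftrightarrow> u = (0,0)" if "u \<in> metacyclic_index" for u
    using inj that idx(1) f0 by (metis inj_onD)
  have eq: "f u \<noteq> \<one> \<and> f u \<otimes> f u = \<one> \<longleftrightarrow> u \<noteq> (0,0) \<and> metacyclic_mult r s u u = (0,0)" if "u \<in> metacyclic_index" for u
    unfolding m(2)[OF that that] f1[OF m(1)[OF that that]] f1[OF that] ..
  have "{g \<in> carrier G. g \<noteq> \<one> \<and> g \<otimes> g = \<one>} = f ` {u \<in> metacyclic_index. f u \<noteq> \<one> \<and> f u \<otimes> f u = \<one>}"
    unfolding img[symmetric] by (rule Compr_image_eq)
  also have "{u \<in> metacyclic_index. f u \<noteq> \<one> \<and> f u \<otimes> f u = \<one>} = {u \<in> metacyclic_index. u \<noteq> (0,0) \<and> metacyclic_mult r s u u = (0,0)}"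
    by (rule Collect_cong, rule conj_cong[OF refl], rule eq)
  finally have "{g \<in> carrier G. g \<noteq> \<one> \<and> g \<otimes> g = \<one>} = f ` {u \<in> metacyclic_index. u \<noteq> (0,0) \<and> metacyclic_mult r s u u = (0,0)}" .
  moreover have "inj_on f {u \<in> metacyclic_index. u \<noteq> (0,0) \<and> metacyclic_mult r s u u = (0,0)}"
    using inj by (rule inj_on_subset) blast
  ultimately show "num_subgroups G 2 = card {u \<in> metacyclic_index. u \<noteq> (0,0) \<and> metacyclic_mult r s u u = (0,0)}"
    unfolding num_subgroups_2 by (simp add: card_image)
  have o: "order G = 8"
  proof -
    have "card (f ` metacyclic_index) = card metacyclic_index" using inj by (rule card_image)
    then show ?thesis unfolding img order_def by (simp add: metacyclic_index_def card_cartesian_product)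
  qed
  have fin: "finite (carrier G)" using o order_gt_0_iff_finite by simp
  let ?z = "f (2,0)"
  have z: "?z \<in> carrier G" "?z \<noteq> \<one>" using fG[OF idx(3)] f1[OF idx(3)] by auto
  have "metacyclic_mult r s (2,0) u = metacyclic_mult r s u (2,0)" if "u \<in> metacyclic_index" for u
    using that rs by (auto simp: metacyclic_index_eq metacyclic_mult_def metacyclic_params_def)
  then have central: "?z \<otimes> g = g \<otimes> ?z" if "g \<in> carrier G" for g
    using that img m(2) idx(3) by (metis imageE)
  have sqm: "metacyclic_mult r s u u \<in> {(0,0),(2,0)}" if "u \<in> metacyclic_index" for u
    using that rs by (auto simp: metacyclic_index_eq metacyclic_mult_def metacyclic_params_def)
  have sq: "g \<otimes> g \<in> {\<one>, ?z}" if g: "g \<in> carrier G" for g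
  proof -
    obtain u where u: "u \<in> metacyclic_index" "g = f u" using g img by blast
    then show ?thesis using m(2)[OF u(1) u(1)] sqm[OF u(1)] f0 by auto
  qed
  have "?z \<in> H" if H: "subgroup H G" "card H = 4" for H
  proof (rule ccontr)
    assume n: "?z \<notin> H"
    let ?A = "f ` ({..<4} \<times> {0})"
    have subI: "{..<4} \<times> {0} \<subseteq> metacyclic_index" by (auto simp: metacyclic_index_def)
    have A: "subgroup ?A G"
    proof (rule subgroup_if_finite_mult_closed[OF fin])
      show "?A \<subseteq> carrier G" using subI fG by blast
      show "?A \<noteq> {}" by (auto simp: lessThan_empty_iff)
      fix x y assume "x \<in> ?A" "y \<in> ?A"
      then obtain i j where ij: "i < 4" "j < 4" "x = f (i, 0)" "y = f (j, 0)" by auto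
      have "x \<otimes> y = f (metacyclic_mult r s (i, 0) (j, 0))" using ij m(2) by (auto simp: metacyclic_index_def)
      also have "metacyclic_mult r s (i, 0) (j, 0) = ((i + j) mod 4, 0)" by (simp add: metacyclic_mult_def)
      finally show "x \<otimes> y \<in> ?A" by simp
    qed
    have cardA: "card ?A = 4" using inj_on_subset[OF inj subI] by (simp add: card_image card_cartesian_product)
    \<comment> \<open>In \<open>?A\<close> the elements with \<open>i = 1\<close> and
      \<open>i = 3\<close> have square \<open>z\<close>, and \<open>i = 2\<close> is
      \<open>z\<close> itself.\<close>
    have "g = \<one>" if g: "g \<in> H" "g \<in> ?A" for g
    proof -
      obtain i where i: "i < 4" "g = f (i, 0)" using g by auto
      have iI: "(i, 0) \<in> metacyclic_index" using i by (simp add: metacyclic_index_def)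
      have "g \<otimes> g \<in> H" using g H by (simp add: subgroup.m_closed)
      then have "f (metacyclic_mult r s (i, 0) (i, 0)) \<noteq> ?z" using n m(2)[OF iI iI] i by auto
      then have "metacyclic_mult r s (i, 0) (i, 0) \<noteq> (2, 0)" by auto
      then have "i \<noteq> 1" "i \<noteq> 3" by (auto simp: metacyclic_mult_def)
      moreover have "i \<noteq> 2" using n g i by auto
      ultimately have "i = 0" using i by linarith
      then show ?thesis using i f0 by simp
    qed
    then have "H \<inter> ?A = {\<one>}" using subgroup.one_closed[OF H(1)] subgroup.one_closed[OF A] by blast
    then have "card H * card ?A \<le> order G" using disjoint_subgroups_card(2)[OF fin H(1) A] by blast
    then show False using H(2) cardA o by simp
  qed
  then have "{H. subgroup H G \<and> card H = 4} = {H. subgroup H G \<and> card H = 4 \<and> ?z \<in> H}" by blast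
  then show "num_subgroups G 4 = 3"
    unfolding num_subgroups_def using card_order_4_subgroups_containing[OF o z central sq] by simp
qed

lemma metacyclic_comm_iff:
  assumes G: "group G" and rs: "(r, s) \<in> metacyclic_params" and f: "coordinates G metacyclic_index (metacyclic_mult r s) f"
  shows "comm_group G \<longleftrightarrow> r = 1"
  unfolding coordinates_comm_iff[OF G f]
proof
  have "(1,0) \<in> metacyclic_index" "(0,1) \<in> metacyclic_index" by (simp_all add: metacyclic_index_eq)
  moreover have "metacyclic_mult 3 s (1,0) (0,1) \<noteq> metacyclic_mult 3 s (0,1) (1,0)" by (simp add: metacyclic_mult_def)
  ultimately show "r = 1" if "\<forall>i\<in>metacyclic_index. \<forall>j\<in>metacyclic_index. metacyclic_mult r s i j = metacyclic_mult r s j i"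
    using that rs unfolding metacyclic_params_def by blast
  show "\<forall>i\<in>metacyclic_index. \<forall>j\<in>metacyclic_index. metacyclic_mult r s i j = metacyclic_mult r s j i" if "r = 1"
    using that by (simp add: metacyclic_mult_def add.commute conj_commute)
qed

text \<open>The two relations move every \<open>y\<close> to the right past powers of
  \<open>x\<close> and turn \<open>y^2\<close> into a power of \<open>x\<close>. The eight normal
  forms are distinct because \<open>y\<close> lies outside the subgroup generated by
  \<open>x\<close>.\<close>

lemma (in group) metacyclic_coordinates:
  assumes o: "order G = 8" and x: "x \<in> carrier G" "ord x = 4" and y: "y \<in> carrier G" "y \<notin> generate G {x}"
    and yx: "y \<otimes> x = x [^] r \<otimes> y" and yy: "y \<otimes> y = x [^] (s::nat)"
  shows "coordinates G metacyclic_index (metacyclic_mult r s) (\<lambda>(i, j). x [^] i \<otimes> y [^] j)"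
proof -
  let ?A = "generate G {x}" and ?f = "\<lambda>(i, j). x [^] i \<otimes> y [^] j"
  have fin: "finite (carrier G)" using o order_gt_0_iff_finite by simp
  have A: "subgroup ?A G" using generate_subgroup_of_order[OF x(1)] by blast
  have xA: "x [^] i \<in> ?A" for i :: nat
    using generate_pow_on_finite_carrier[OF fin x(1)] by blast
  have "{0..ord x - 1} = {..<4}" using x by auto
  then have injx: "inj_on (\<lambda>i. x [^] i) {..<4::nat}" using ord_inj[OF x(1)] by simp
  have ne: "x [^] i \<noteq> x [^] k \<otimes> y" for i k :: nat
  proof
    assume "x [^] i = x [^] k \<otimes> y"
    then have "y = inv (x [^] k) \<otimes> x [^] i" using x y by (simp add: inv_solve_left)
    then have "y \<in> ?A" using A xA by (simp add: subgroup.m_closed subgroup.m_inv_closed)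
    then show False using y by simp
  qed
  have pow2: "j = 0 \<or> j = 1" if "j < 2" for j :: nat using that by linarith
  have inj: "inj_on ?f metacyclic_index"
  proof (rule inj_onI)
    fix u v assume uv: "u \<in> metacyclic_index" "v \<in> metacyclic_index" "?f u = ?f v"
    obtain i j k l where ij: "u = (i, j)" "v = (k, l)" by (cases u, cases v) blast
    have b: "i < 4" "j < 2" "k < 4" "l < 2" using uv ij by (auto simp: metacyclic_index_def)
    have e: "x [^] i \<otimes> y [^] j = x [^] k \<otimes> y [^] l" using uv(3) ij by simp
    have jl: "j = l" using pow2[OF b(2)] pow2[OF b(4)] e ne[of i k] ne[of k i] x y by auto
    then have "x [^] i = x [^] k" using e x y by simp
    then have "i = k" using injx b by (simp add: inj_on_def)
    then show "u = v" using jl ij by simp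
  qed
  have "card (?f ` metacyclic_index) = 8" using inj by (simp add: card_image metacyclic_index_def card_cartesian_product)
  then have "?f ` metacyclic_index = carrier G"
    using fin o x y by (intro card_subset_eq) (auto simp: order_def)
  moreover have "?f u \<otimes> ?f v = ?f (metacyclic_mult r s u v)" if uv: "u \<in> metacyclic_index" "v \<in> metacyclic_index" for u v
  proof -
    obtain i j k l where ij: "u = (i, j)" "v = (k, l)" by (cases u, cases v) blast
    have b: "j < 2" "l < 2" using uv ij by (auto simp: metacyclic_index_def)
    have yxk: "y \<otimes> x [^] k = x [^] (r * k) \<otimes> y" for k :: nat
    proof (induction k)
      case (Suc k)
      have "y \<otimes> x [^] Suc k = (y \<otimes> x [^] k) \<otimes> x" using x y by (simp add: m_assoc)
      also have "\<dots> = x [^] (r * k) \<otimes> (y \<otimes> x)" unfolding Suc using x y by (simp add: m_assoc)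
      also have "\<dots> = x [^] (r * k) \<otimes> x [^] r \<otimes> y" unfolding yx using x y by (simp add: m_assoc)
      also have "\<dots> = x [^] (r * Suc k) \<otimes> y" using x by (simp add: nat_pow_mult add.commute)
      finally show ?case .
    qed (use y in simp)
    have yxj: "y [^] j \<otimes> x [^] k = x [^] (r ^ j * k) \<otimes> y [^] j"
      using pow2[OF b(1)] yxk[of k] x y by auto
    have yjl: "y [^] j \<otimes> y [^] l = x [^] (if j = 1 \<and> l = 1 then s else 0) \<otimes> y [^] ((j + l) mod 2)"
      using pow2[OF b(1)] pow2[OF b(2)] yy x y by auto
    have mod4: "x [^] n = x [^] (n mod 4)" for n :: nat
    proof -
      have "int (ord x) dvd int n - int (n mod 4)" using x(2) by (simp add: zmod_int minus_mod_eq_mult_div)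
      then have "x [^] int (n mod 4) = x [^] int n" using int_pow_eq[OF x(1)] by blast
      then show ?thesis by (simp only: int_pow_int)
    qed
    have "?f u \<otimes> ?f v = x [^] i \<otimes> (y [^] j \<otimes> x [^] k) \<otimes> y [^] l" using ij x y by (simp add: m_assoc)
    also have "\<dots> = x [^] i \<otimes> x [^] (r ^ j * k) \<otimes> (y [^] j \<otimes> y [^] l)" unfolding yxj using x y by (simp add: m_assoc)
    also have "\<dots> = x [^] (i + r ^ j * k + (if j = 1 \<and> l = 1 then s else 0)) \<otimes> y [^] ((j + l) mod 2)"
      unfolding yjl using x y by (simp add: nat_pow_mult flip: m_assoc)
    also have "\<dots> = x [^] ((i + r ^ j * k + (if j = 1 \<and> l = 1 then s else 0)) mod 4) \<otimes> y [^] ((j + l) mod 2)"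
      using mod4 by (rule arg_cong)
    also have "\<dots> = ?f (metacyclic_mult r s u v)" by (simp add: metacyclic_mult_def ij)
    finally show ?thesis .
  qed
  moreover have "metacyclic_mult r s u v \<in> metacyclic_index" for u v by (simp add: metacyclic_mult_def metacyclic_index_def)
  ultimately show ?thesis using inj by (simp add: coordinates_def bij_betw_def)
qed

lemma (in group) order_8_ord:
  assumes o: "order G = 8" and x: "x \<in> carrier G"
  shows "ord x = 1 \<or> ord x = 2 \<or> ord x = 4 \<or> ord x = 8"
proof -
  have "ord x dvd 2 ^ 3" using ord_dvd_group_order[OF x] o by simp
  then obtain i where "i \<le> 3" "ord x = 2 ^ i" using two_is_prime_nat divides_primepow_nat by blast
  moreover from this have "i = 0 \<or> i = 1 \<or> i = 2 \<or> i = 3" by linarith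
  ultimately show ?thesis by auto
qed

text \<open>The element \<open>x\<close> has order 4, and the group is the union of
  \<open>?A\<close> and the coset of \<open>y\<close>. Locating \<open>y x\<close> and
  \<open>y y\<close> in these two cosets yields \<open>r\<close> and \<open>s\<close>; most values
  contradict the order of \<open>x\<close> or the absence of elements of order 8.\<close>

lemma (in group) metacyclic_exists:
  assumes o: "order G = 8" and nc: "\<And>x. x \<in> carrier G \<Longrightarrow> ord x \<noteq> order G"
    and x: "x \<in> carrier G" "x \<otimes> x \<noteq> \<one>"
  shows "\<exists>r s f. (r, s) \<in> metacyclic_params \<and> coordinates G metacyclic_index (metacyclic_mult r s) f"
proof -
  have fin: "finite (carrier G)" using o order_gt_0_iff_finite by simp
  have x2: "x [^] (2::nat) \<noteq> \<one>" using x by (simp add: numeral_2_eq_2)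
  then have "\<not> ord x dvd 2" using pow_eq_id[OF x(1)] by blast
  then have ordx: "ord x = 4" using order_8_ord[OF o x(1)] nc[OF x(1)] o by auto
  have x4: "x [^] (4::nat) = \<one>" using pow_eq_id[OF x(1), of 4] ordx by simp
  let ?A = "generate G {x}"
  have A: "subgroup ?A G" "card ?A = 4" using generate_subgroup_of_order[OF x(1)] ordx by auto
  have A_eq: "\<exists>i<4::nat. a = x [^] i" if a: "a \<in> ?A" for a
  proof -
    obtain k :: nat where k: "a = x [^] k" using a generate_pow_on_finite_carrier[OF fin x(1)] by blast
    have "x [^] k = x [^] (k mod 4)"
    proof -
      have "x [^] k = x [^] (k mod 4 + 4 * (k div 4))" by simp
      also have "\<dots> = x [^] (k mod 4) \<otimes> (x [^] (4::nat)) [^] (k div 4)"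
        using x(1) by (simp only: nat_pow_mult nat_pow_pow nat_pow_closed)
      finally show ?thesis using x4 x(1) by simp
    qed
    then show ?thesis using k by (intro exI[of _ "k mod 4"]) simp
  qed
  have xA: "x [^] i \<in> ?A" for i :: nat
    using generate_pow_on_finite_carrier[OF fin x(1)] by blast
  have "?A \<noteq> carrier G" using A o by (auto simp: order_def)
  then obtain y where y: "y \<in> carrier G" "y \<notin> ?A" using A subgroup.subset by blast
  have AG: "?A \<subseteq> carrier G" using A(1) by (rule subgroup.subset)
  have notA: "a \<otimes> y \<notin> ?A" if a: "a \<in> ?A" for a
  proof
    assume "a \<otimes> y \<in> ?A"
    then have "inv a \<otimes> (a \<otimes> y) \<in> ?A" using A(1) a by (simp add: subgroup.m_closed subgroup.m_inv_closed)
    moreover have "inv a \<otimes> (a \<otimes> y) = y" using a y AG by (auto simp flip: m_assoc)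
    ultimately show False using y by simp
  qed
  have car: "carrier G = ?A \<union> (\<lambda>a. a \<otimes> y) ` ?A"
  proof -
    have "inj_on (\<lambda>a. a \<otimes> y) ?A" using AG y by (intro inj_onI) (simp add: subset_iff)
    then have "card ((\<lambda>a. a \<otimes> y) ` ?A) = 4" using A(2) by (simp add: card_image)
    moreover have "?A \<inter> (\<lambda>a. a \<otimes> y) ` ?A = {}" using notA by blast
    moreover have "finite ?A" using AG fin finite_subset by blast
    ultimately have "card (?A \<union> (\<lambda>a. a \<otimes> y) ` ?A) = order G" using A(2) o by (simp add: card_Un_disjoint)
    moreover have "?A \<union> (\<lambda>a. a \<otimes> y) ` ?A \<subseteq> carrier G" using AG y by auto
    ultimately show ?thesis using fin by (metis card_subset_eq order_def)
  qed
  obtain r :: nat where r: "r < 4" "y \<otimes> x = x [^] r \<otimes> y"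
  proof -
    have "y \<otimes> x \<notin> ?A"
    proof
      assume "y \<otimes> x \<in> ?A"
      then have "y \<otimes> x \<otimes> inv x \<in> ?A"
        using A(1) generate_subgroup_of_order(3)[OF x(1)] by (simp add: subgroup.m_closed subgroup.m_inv_closed)
      then show False using x y by (simp add: m_assoc)
    qed
    moreover have "y \<otimes> x \<in> carrier G" using x y by simp
    ultimately obtain a where "a \<in> ?A" "y \<otimes> x = a \<otimes> y" using car by blast
    then show ?thesis using A_eq that by blast
  qed
  obtain s :: nat where s: "s < 4" "y \<otimes> y = x [^] s"
  proof -
    have "y \<otimes> y \<noteq> a \<otimes> y" if "a \<in> ?A" for a
      using that y AG by auto
    moreover have "y \<otimes> y \<in> carrier G" using y by simp
    ultimately have "y \<otimes> y \<in> ?A" using car by blast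
    then show ?thesis using A_eq that by blast
  qed
  have "r \<noteq> 0"
  proof
    assume "r = 0"
    then have "y \<otimes> x = y" using r y by simp
    then have "x = \<one>" using x y by simp
    then show False using x by simp
  qed
  moreover have "r \<noteq> 2"
  proof
    assume "r = 2"
    \<comment> \<open>Moving \<open>y\<close> past \<open>x\<close> twice gives
      \<open>y x^2 = x^4 y = y\<close>, which contradicts the order of \<open>x\<close>.\<close>
    with r(2) have yx: "y \<otimes> x = x [^] (2::nat) \<otimes> y" by (simp only:)
    have "y \<otimes> x [^] (2::nat) = (y \<otimes> x) \<otimes> x" using x y by (simp add: numeral_2_eq_2 m_assoc)
    also have "\<dots> = x [^] (2::nat) \<otimes> y \<otimes> x" by (simp only: yx)
    also have "\<dots> = x [^] (2::nat) \<otimes> (y \<otimes> x)" using x y by (simp add: m_assoc)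
    also have "\<dots> = x [^] (2::nat) \<otimes> (x [^] (2::nat) \<otimes> y)" by (simp only: yx)
    also have "\<dots> = x [^] (2::nat) \<otimes> x [^] (2::nat) \<otimes> y" using x y by (simp add: m_assoc)
    also have "\<dots> = y" using x4 x y by (simp add: nat_pow_mult)
    finally have "x [^] (2::nat) = \<one>" using x y by simp
    then show False using x2 by simp
  qed
  moreover have "r = 0 \<or> r = 1 \<or> r = 2 \<or> r = 3" using r(1) by linarith
  ultimately have r13: "r = 1 \<or> r = 3" by blast
  \<comment> \<open>For odd \<open>s\<close> the power \<open>y^4 = x^(2 s)\<close> is nontrivial,
    and \<open>y\<close> would have order 8.\<close>
  have s02: "s = 0 \<or> s = 2"
  proof (rule ccontr)
    assume "\<not> (s = 0 \<or> s = 2)"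
    then have s13: "s = 1 \<or> s = 3" using s(1) by linarith
    have "y [^] (4::nat) = (y \<otimes> y) [^] (2::nat)" using y by (simp add: numeral_eq_Suc m_assoc)
    also have "\<dots> = x [^] (s * 2)" unfolding s(2) using x by (simp add: nat_pow_pow)
    also have "\<dots> \<noteq> \<one>" using pow_eq_id[OF x(1), of "s * 2"] ordx s13 by auto
    finally have "\<not> ord y dvd 4" using pow_eq_id[OF y(1)] by blast
    then have "ord y = 8" using order_8_ord[OF o y(1)] by auto
    then show False using nc[OF y(1)] o by simp
  qed
  show ?thesis
  \<comment> \<open>The pair \<open>(1, 2)\<close> is another presentation of the abelian type:
    replacing \<open>y\<close> by \<open>x y\<close>, whose square is \<open>x^4 = 1\<close>,
    changes it to \<open>(1, 0)\<close>.\<close>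
  proof (cases "r = 1 \<and> s = 2")
    case False
    then have "(r, s) \<in> metacyclic_params" using r13 s02 by (auto simp: metacyclic_params_def)
    then show ?thesis using metacyclic_coordinates[OF o x(1) ordx y r(2) s(2)] by blast
  next
    case True
    let ?w = "x \<otimes> y"
    have yx: "y \<otimes> x = x \<otimes> y" using r True x by simp
    have w: "?w \<in> carrier G" "?w \<notin> ?A" using x y notA generate_subgroup_of_order(3)[OF x(1)] by auto
    have wx: "?w \<otimes> x = x [^] (1::nat) \<otimes> ?w" using x y yx by (simp add: m_assoc)
    have "?w \<otimes> ?w = x \<otimes> (y \<otimes> x) \<otimes> y" using x y by (simp add: m_assoc)
    also have "\<dots> = x \<otimes> x \<otimes> (y \<otimes> y)" unfolding yx using x y by (simp add: m_assoc)
    also have "\<dots> = x [^] (2::nat) \<otimes> x [^] (2::nat)" using s True x by (simp add: numeral_2_eq_2)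
    also have "\<dots> = x [^] (0::nat)" using x4 x by (simp add: nat_pow_mult)
    finally have "coordinates G metacyclic_index (metacyclic_mult 1 0) (\<lambda>(i, j). x [^] i \<otimes> ?w [^] j)"
      using metacyclic_coordinates[OF o x(1) ordx w wx] by blast
    then show ?thesis unfolding metacyclic_params_def by blast
  qed
qed

text \<open>Either some element has order 8, or all squares are trivial, or there is a nontrivial
  square and no element of order 8. The counts are part of each case so that both the classification
  and the symmetry can be read off one table.\<close>

lemma (in group) order_8_cases:
  assumes o: "order G = 8"
  obtains (cyclic) x where "x \<in> carrier G" "ord x = order G" "num_subgroups G 2 = 1" "num_subgroups G 4 = 1" "comm_group G"
  | (exponent_2) "\<And>g. g \<in> carrier G \<Longrightarrow> g \<otimes> g = \<one>" "num_subgroups G 2 = 7" "num_subgroups G 4 = 7" "comm_group G"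
  | (abelian) f where "coordinates G metacyclic_index (metacyclic_mult 1 0) f" "num_subgroups G 2 = 3" "num_subgroups G 4 = 3" "comm_group G"
  | (dihedral) f where "coordinates G metacyclic_index (metacyclic_mult 3 0) f" "num_subgroups G 2 = 5" "num_subgroups G 4 = 3" "\<not> comm_group G"
  | (quaternion) f where "coordinates G metacyclic_index (metacyclic_mult 3 2) f" "num_subgroups G 2 = 1" "num_subgroups G 4 = 3" "\<not> comm_group G"
proof -
  have fin: "finite (carrier G)" using o order_gt_0_iff_finite by simp
  consider x where "x \<in> carrier G" "ord x = order G"
    | "\<And>g. g \<in> carrier G \<Longrightarrow> g \<otimes> g = \<one>"
    | x where "\<And>x. x \<in> carrier G \<Longrightarrow> ord x \<noteq> order G" "x \<in> carrier G" "x \<otimes> x \<noteq> \<one>" by blast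
  then show thesis
  proof cases
    case (1 x)
    have "num_subgroups G (2 ^ j) = 1" if "2 ^ j dvd order G" for j
      using cyclic_num_subgroups_le_1[OF fin 1, of "2 ^ j"] num_subgroups_prime_power_pos[OF fin two_is_prime_nat that] by simp
    from this[of 1] this[of 2] have "num_subgroups G 2 = 1" "num_subgroups G 4 = 1" using o by auto
    then show ?thesis using cyclic[OF 1] cyclic_comm[OF fin 1] by blast
  next
    case 2
    then show ?thesis using exponent_2 exponent_2_order_8[OF o] by blast
  next
    case (3 x)
    obtain r s f where rs: "(r, s) \<in> metacyclic_params" "coordinates G metacyclic_index (metacyclic_mult r s) f"
      using metacyclic_exists[OF o 3] by blast
    note n = metacyclic_num_subgroups[OF rs] metacyclic_comm_iff[OF group_axioms rs]
    consider "r = 1" "s = 0" | "r = 3" "s = 0" | "r = 3" "s = 2" using rs(1) by (auto simp: metacyclic_params_def)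
    then show ?thesis
    proof cases
      case 1
      then show ?thesis using abelian[of f] n rs(2) metacyclic_involutions(1) by simp
    next
      case 2
      then show ?thesis using dihedral[of f] n rs(2) metacyclic_involutions(2) by simp
    next
      case 3
      then show ?thesis using quaternion[of f] n rs(2) metacyclic_involutions(3) by simp
    qed
  qed
qed

lemma order_8_iso:
  assumes G: "group G" "order G = 8" and H: "group H" "order H = 8"
    and eq: "num_subgroups G 2 = num_subgroups H 2" "num_subgroups G 4 = num_subgroups H 4"
  shows "G \<cong> H"
proof -
  have fin: "finite (carrier G)" "finite (carrier H)"
    using G H monoid.order_gt_0_iff_finite[OF group.is_monoid] by (metis zero_less_numeral)+
  show ?thesis
  proof (cases rule: group.order_8_cases[OF G])
    case (1 x)
    then show ?thesis
      by (cases rule: group.order_8_cases[OF H]) (use eq cyclic_iso[OF G(1) fin(1) _ _ H(1) fin(2)] G H in auto)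
  next
    case 2
    then show ?thesis
      by (cases rule: group.order_8_cases[OF H]) (use eq exponent_2_order_8_iso[OF G _ H] in auto)
  next
    case (3 f)
    then show ?thesis
      by (cases rule: group.order_8_cases[OF H]) (use eq iso_if_same_coordinates in auto)
  next
    case (4 f)
    then show ?thesis
      by (cases rule: group.order_8_cases[OF H]) (use eq iso_if_same_coordinates in auto)
  next
    case (5 f)
    then show ?thesis
      by (cases rule: group.order_8_cases[OF H]) (use eq iso_if_same_coordinates in auto)
  qed
qed

text \<open>The converse assumes the equation only at s = 1, since for a Sylow subgroup it is
  recovered only at real arguments. There 1 + a_2/2 + a_4/4 + 1/8 = (1 + 2 a_2 + 4 a_4 + 8)/8
  reduces to a_2 = a_4.\<close>

lemma (in group) order_8_symmetry:
  assumes o: "order G = 8"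
  shows "comm_group G \<Longrightarrow> zeta_symmetric G"
    and "group_zeta G 1 = 1 / of_nat (order G) powr 1 * group_zeta G (- 1) \<Longrightarrow> comm_group G"
proof -
  have fin: "finite (carrier G)" using o order_gt_0_iff_finite by simp
  have D: "{d. d dvd order G} = {1, 2, 4, 8}"
  proof -
    have "d dvd 8 \<longleftrightarrow> d \<in> {1, 2, 4, 8}" for d :: nat
    proof
      assume "d dvd 8"
      then have "d dvd 2 ^ 3" by simp
      then obtain i where "i \<le> 3" "d = 2 ^ i" using two_is_prime_nat divides_primepow_nat by blast
      moreover from this have "i = 0 \<or> i = 1 \<or> i = 2 \<or> i = 3" by linarith
      ultimately show "d \<in> {1, 2, 4, 8}" by auto
    qed auto
    then show ?thesis using o by auto
  qed
  have a18: "num_subgroups G 1 = 1" "num_subgroups G 8 = 1"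
    using num_subgroups_1 num_subgroups_order[OF fin] o by auto
  have comm: "comm_group G \<longleftrightarrow> num_subgroups G 2 = num_subgroups G 4"
    by (cases rule: order_8_cases[OF o]) auto
  show "zeta_symmetric G" if "comm_group G"
  proof (rule zeta_symmetricI[OF group_axioms fin])
    fix d assume "d dvd order G"
    then have "d \<in> {1, 2, 4, 8}" using D by blast
    then show "num_subgroups G d = num_subgroups G (order G div d)" using comm that a18 o by auto
  qed
  show "comm_group G" if "group_zeta G 1 = 1 / of_nat (order G) powr 1 * group_zeta G (- 1)"
  proof -
    have "(of_nat (num_subgroups G 2) :: complex) = of_nat (num_subgroups G 4)"
      using that a18 o unfolding group_zeta_sum_divisors[OF group_axioms fin] D
      by (simp add: powr_minus field_simps)
    then show ?thesis using comm by simp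
  qed
qed

section \<open>The theorem\<close>

lemma small_prime_power_iso:
  assumes p: "Factorial_Ring.prime p" and k: "k \<le> 2 \<or> p = 2 \<and> k \<le> 3"
    and G: "group G" "order G = p ^ k" and H: "group H" "order H = p ^ k"
    and eq: "\<And>j. num_subgroups G (p ^ j) = num_subgroups H (p ^ j)"
  shows "G \<cong> H"
proof (cases "k \<le> 2")
  case True
  then show ?thesis using prime_power_le_2_iso[OF p G H] eq[of 1] by simp
next
  case False
  then have "p = 2" "k = 3" using k by auto
  then show ?thesis using order_8_iso[OF G(1) _ H(1)] G(2) H(2) eq[of 1] eq[of 2] by simp
qed

text \<open>All subgroups of this order lie in \<open>P\<close>, and the only one of full order in
  \<open>P\<close> is \<open>P\<close>. With the converse above, normality of Sylow subgroups
  becomes a property of the counts.\<close>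

lemma sylow_normal_num_subgroups:
  assumes G: "group G" "finite (carrier G)" and syl: "sylow_normal G" and p: "Factorial_Ring.prime p"
  shows "num_subgroups G (p ^ multiplicity p (order G)) = 1"
proof -
  obtain P where P: "P \<lhd> G" "card P = p ^ multiplicity p (order G)"
    using syl p unfolding sylow_normal_def by blast
  have "finite P" using P p prime_gt_0_nat by (metis card_gt_0_iff zero_less_power)
  then show ?thesis
    using num_subgroups_normal_sylow[OF P(1) G(2) p P(2)] P(2)
      group.num_subgroups_order[OF normal_imp_group[OF P(1)]] by (simp add: order_def)
qed

lemma iso_if_zeta_eq:
  assumes G: "group G" "finite (carrier G)" and syl: "sylow_normal G"
    and small: "\<And>p. Factorial_Ring.prime p \<Longrightarrow> multiplicity p (order G) \<le> 2 \<or> p = 2 \<and> multiplicity p (order G) \<le> 3"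
    and G': "group G'" "finite (carrier G')" and eq: "group_zeta G' = group_zeta G"
  shows "G' \<cong> G"
proof -
  let ?n = "order G"
  have n: "?n > 0" using G by (simp add: monoid.order_gt_0_iff_finite group.is_monoid)
  have o: "order G' = ?n" by (rule order_eq_if_zeta_eq[OF G' G eq])
  have a: "num_subgroups G' m = num_subgroups G m" for m by (rule num_subgroups_eq_if_zeta_eq[OF G' G eq])
  \<comment> \<open>This is where \<open>G'\<close> turns out to be nilpotent as well: its counts at
    the full prime powers are 1, like those of \<open>G\<close>.\<close>
  have syl': "sylow_normal G'"
    using group.sylow_normal_if_num_subgroups[OF G'(1)] sylow_normal_num_subgroups[OF G syl] a o by simp
  have "\<exists>P P'. P \<lhd> G \<and> P' \<lhd> G' \<and> card P = p ^ multiplicity p ?n \<and> card P' = p ^ multiplicity p ?n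
      \<and> G'\<lparr>carrier := P'\<rparr> \<cong> G\<lparr>carrier := P\<rparr>" if "p \<in> prime_factors ?n" for p
  proof -
    have p: "Factorial_Ring.prime p" using that by auto
    obtain P where P: "P \<lhd> G" "card P = p ^ multiplicity p ?n"
      using syl p unfolding sylow_normal_def by blast
    obtain P' where P': "P' \<lhd> G'" "card P' = p ^ multiplicity p ?n"
      using syl' p o unfolding sylow_normal_def by metis
    have "G'\<lparr>carrier := P'\<rparr> \<cong> G\<lparr>carrier := P\<rparr>"
      using num_subgroups_normal_sylow[OF P(1) G(2) p P(2)] num_subgroups_normal_sylow[OF P'(1) G'(2) p] P P' o a
      by (intro small_prime_power_iso[OF p small[OF p]] normal_imp_group) (auto simp: order_def)
    then show ?thesis using P P' by blast
  qed
  then obtain K K' where K: "card K = (\<Prod>p\<in>prime_factors ?n. p ^ multiplicity p ?n)" "K \<lhd> G"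
      "card K' = (\<Prod>p\<in>prime_factors ?n. p ^ multiplicity p ?n)" "K' \<lhd> G'"
      "G'\<lparr>carrier := K'\<rparr> \<cong> G\<lparr>carrier := K\<rparr>"
    using iso_normal_hall[OF G(1) G'(1), of "prime_factors ?n" "\<lambda>p. multiplicity p ?n"] by auto
  have "?n = (\<Prod>p\<in>prime_factors ?n. p ^ multiplicity p ?n)"
    using n by (intro prime_factorization_nat)
  then have "K = carrier G" "K' = carrier G'"
    using K G G' o subgroup.subset[OF normal_imp_subgroup] by (metis card_subset_eq order_def)+
  then show ?thesis using K(5) by simp
qed

text \<open>Divide the equation for the product by the one for \<open>G\<close>; the argument is
  real so that the factor \<open>group_zeta G\<close> is nonzero.\<close>

lemma zeta_symmetric_cancel:
  assumes G: "group G" "finite (carrier G)" and H: "group H" and cop: "coprime (order G) (order H)"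
    and sym: "zeta_symmetric G" "zeta_symmetric (G \<times>\<times> H)"
  shows "group_zeta H (of_real r) = 1 / of_nat (order H) powr (of_real r) * group_zeta H (- of_real r)"
proof -
  let ?s = "of_real r :: complex"
  define a b where "a = (of_nat (order G) powr ?s :: complex)" and "b = (of_nat (order H) powr ?s :: complex)"
  have 1: "group_zeta G ?s = 1 / a * group_zeta G (- ?s)"
    using sym(1) unfolding zeta_symmetric_def a_def by blast
  have "group_zeta G ?s * group_zeta H ?s = 1 / (a * b) * (group_zeta G (- ?s) * group_zeta H (- ?s))"
    using spec[OF sym(2)[unfolded zeta_symmetric_def], of ?s]
    unfolding group_zeta_DirProd[OF G(1) H cop] order_DirProd of_nat_mult_powr a_def b_def .
  also have "\<dots> = (1 / a * group_zeta G (- ?s)) * (1 / b * group_zeta H (- ?s))" by simp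
  also have "\<dots> = group_zeta G ?s * (1 / b * group_zeta H (- ?s))" by (simp only: 1)
  finally show ?thesis using group_zeta_of_real_nonzero[OF G, of r] unfolding b_def by (simp only: mult_left_cancel not_False_eq_True)
qed

lemma subgroup_comm:
  assumes "comm_group G" "subgroup H G" shows "comm_group (G\<lparr>carrier := H\<rparr>)"
proof -
  interpret comm_group G by fact
  show ?thesis
    using subgroup.subset[OF assms(2)]
    by (intro group.group_comm_groupI[OF subgroup_imp_group[OF assms(2)]]) (auto intro: m_comm)
qed

text \<open>The group is the product of its odd part \<open>K\<close>, which is always symmetric and
  commutative, and its Sylow 2-subgroup \<open>P\<close>. So either property of the group comes down
  to the same property of \<open>P\<close>.\<close>

lemma (in group) symmetric_iff_comm:
  assumes fin: "finite (carrier G)" and syl: "sylow_normal G"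
    and small: "\<And>p. Factorial_Ring.prime p \<Longrightarrow> multiplicity p (order G) \<le> 2 \<or> p = 2 \<and> multiplicity p (order G) \<le> 3"
  shows "zeta_symmetric G \<longleftrightarrow> comm_group G"
proof -
  let ?n = "order G" and ?e = "\<lambda>p. multiplicity p (order G)"
  let ?S = "prime_factors ?n - {2}"
  have n: "?n > 0" using fin order_gt_0_iff_finite by blast
  have "\<exists>P. P \<lhd> G \<and> card P = p ^ ?e p \<and> zeta_symmetric (G\<lparr>carrier := P\<rparr>) \<and> comm_group (G\<lparr>carrier := P\<rparr>)"
    if "p \<in> ?S" for p
  proof -
    have p: "Factorial_Ring.prime p" "p \<noteq> 2" using that by auto
    obtain P where P: "P \<lhd> G" "card P = p ^ ?e p" using syl p unfolding sylow_normal_def by blast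
    have "order (G\<lparr>carrier := P\<rparr>) = p ^ ?e p" "?e p \<le> 2" using P small[OF p(1)] p(2) by (auto simp: order_def)
    then show ?thesis
      using P prime_power_le_2_symmetric[OF normal_imp_group p(1)] prime_power_le_2_comm[OF normal_imp_group p(1)] by blast
  qed
  then obtain K where K: "K \<lhd> G" "card K = (\<Prod>p\<in>?S. p ^ ?e p)"
      "zeta_symmetric (G\<lparr>carrier := K\<rparr>)" "comm_group (G\<lparr>carrier := K\<rparr>)"
    using symmetric_normal_hall[OF group_axioms, of ?S ?e] by auto
  obtain P where P: "P \<lhd> G" "card P = 2 ^ ?e 2"
    using syl two_is_prime_nat unfolding sylow_normal_def by blast
  have "coprime (\<Prod>p\<in>?S. p ^ ?e p) (2 ^ ?e 2)"
    by (rule coprime_prod_prime_powers) (use two_is_prime_nat in auto)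
  then have cop: "coprime (card K) (card P)" using K P by simp
  note KP = coprime_normal_set_mult[OF K(1) P(1) cop]
  have "card K * card P = ?n"
  proof -
    have n_eq: "?n = (\<Prod>p\<in>prime_factors ?n. p ^ ?e p)" using n by (intro prime_factorization_nat)
    show ?thesis
    \<comment> \<open>For odd order \<open>P\<close> is trivial, and removing 2 from the prime
      factors changes nothing.\<close>
    proof (cases "2 \<in> prime_factors ?n")
      case True
      then show ?thesis using n_eq K P by (simp add: prod.remove[of _ 2] mult.commute)
    next
      case False
      then have "?e 2 = 0" using n two_is_prime_nat by (simp add: prime_factors_multiplicity)
      then show ?thesis using n_eq K P False by simp
    qed
  qed
  then have "K <#> P = carrier G"
    using KP(1,2) fin subgroup.subset[OF normal_imp_subgroup] by (metis card_subset_eq order_def)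
  then have iso: "G\<lparr>carrier := K\<rparr> \<times>\<times> G\<lparr>carrier := P\<rparr> \<cong> G" using KP(3) by simp
  interpret K: group "G\<lparr>carrier := K\<rparr>" using K(1) by (rule normal_imp_group)
  interpret P: group "G\<lparr>carrier := P\<rparr>" using P(1) by (rule normal_imp_group)
  have oP: "order (G\<lparr>carrier := P\<rparr>) = 2 ^ ?e 2" using P by (simp add: order_def)
  have cop': "coprime (order (G\<lparr>carrier := K\<rparr>)) (order (G\<lparr>carrier := P\<rparr>))" using cop by (simp add: order_def)
  have finK: "finite (carrier (G\<lparr>carrier := K\<rparr>))"
    using subgroup.subset[OF normal_imp_subgroup[OF K(1)]] fin finite_subset by auto
  have sym: "zeta_symmetric G \<longleftrightarrow> zeta_symmetric (G\<lparr>carrier := K\<rparr> \<times>\<times> G\<lparr>carrier := P\<rparr>)"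
    using zeta_symmetric_iso[OF DirProd_group[OF K.group_axioms P.group_axioms] group_axioms iso] by simp
  show ?thesis
  proof
    assume "comm_group G"
    then have "comm_group (G\<lparr>carrier := P\<rparr>)" using subgroup_comm normal_imp_subgroup P(1) by blast
    then have "zeta_symmetric (G\<lparr>carrier := P\<rparr>)"
      using prime_power_le_2_symmetric[OF P.group_axioms two_is_prime_nat oP] P.order_8_symmetry(1) small[OF two_is_prime_nat] oP
      by (cases "?e 2 = 3") auto
    then show "zeta_symmetric G"
      using sym zeta_symmetric_DirProd[OF K.group_axioms P.group_axioms cop' K(3)] by simp
  next
    assume "zeta_symmetric G"
    then have *: "zeta_symmetric (G\<lparr>carrier := K\<rparr> \<times>\<times> G\<lparr>carrier := P\<rparr>)" using sym by simp
    \<comment> \<open>Order at most 4 is commutative anyway; for order 8 the equation for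
      \<open>P\<close> at s = 1 decides.\<close>
    have "comm_group (G\<lparr>carrier := P\<rparr>)"
      using prime_power_le_2_comm[OF P.group_axioms two_is_prime_nat oP] P.order_8_symmetry(2) small[OF two_is_prime_nat] oP
        zeta_symmetric_cancel[OF K.group_axioms finK P.group_axioms cop' K(3) *, of 1]
      by (cases "?e 2 = 3") auto
    then show "comm_group G" using comm_group_iso[OF comm_group_DirProd[OF K(4)] group_axioms iso] by simp
  qed
qed

theorem theorem1p5:
  fixes n :: nat
  assumes "n > 0"
  shows "((\<exists>p. Factorial_Ring.prime p \<and> odd p \<and> multiplicity p n \<ge> 3) \<or> multiplicity 2 n \<ge> 4 \<longrightarrow>
           (\<exists>(G :: nat monoid) (G' :: nat monoid).
              comm_group G \<and> order G = n \<and>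
              nilpotent_group G' \<and> \<not> comm_group G' \<and> order G' = n \<and>
              group_zeta G = group_zeta G'))
       \<and> ((\<forall>p. Factorial_Ring.prime p \<and> odd p \<longrightarrow> multiplicity p n \<le> 2) \<and> multiplicity 2 n \<le> 3 \<longrightarrow>
           (\<forall>G :: ('a, 'c) monoid_scheme. nilpotent_group G \<and> order G = n \<longrightarrow>
              (\<forall>G' :: ('b, 'd) monoid_scheme.
                 group G' \<and> finite (carrier G') \<and> group_zeta G' = group_zeta G \<longrightarrow> G' \<cong> G) \<and>
              ((\<forall>s. group_zeta G s = 1 / of_nat (order G) powr s * group_zeta G (- s))
                 \<longleftrightarrow> comm_group G)))"
proof (intro conjI[OF impI impI] allI impI)
  show "\<exists>(G :: nat monoid) (G' :: nat monoid). comm_group G \<and> order G = n \<and>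
      nilpotent_group G' \<and> \<not> comm_group G' \<and> order G' = n \<and> group_zeta G = group_zeta G'"
    if "(\<exists>p. Factorial_Ring.prime p \<and> odd p \<and> multiplicity p n \<ge> 3) \<or> multiplicity 2 n \<ge> 4"
    using exists_nonabelian_same_zeta[OF assms that] .
next
  fix G :: "('a, 'c) monoid_scheme"
  assume small: "(\<forall>p. Factorial_Ring.prime p \<and> odd p \<longrightarrow> multiplicity p n \<le> 2) \<and> multiplicity 2 n \<le> 3"
    and G: "nilpotent_group G \<and> order G = n"
  interpret nilpotent_group G using G by blast
  have fin: "finite (carrier G)" using G assms order_gt_0_iff_finite by blast
  have syl: "sylow_normal G" by (rule sylow_normal[OF fin])
  have small': "multiplicity p (order G) \<le> 2 \<or> p = 2 \<and> multiplicity p (order G) \<le> 3"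
    if "Factorial_Ring.prime p" for p :: nat
    using small G that prime_odd_nat by (metis le_neq_implies_less prime_ge_2_nat)
  show "(\<forall>G' :: ('b, 'd) monoid_scheme.
       group G' \<and> finite (carrier G') \<and> group_zeta G' = group_zeta G \<longrightarrow> G' \<cong> G) \<and>
     ((\<forall>s. group_zeta G s = 1 / of_nat (order G) powr s * group_zeta G (- s)) \<longleftrightarrow> comm_group G)"
    using iso_if_zeta_eq[OF group_axioms fin syl small'] symmetric_iff_comm[OF fin syl small']
    unfolding zeta_symmetric_def by blast
qed

end
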